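(* There exist constants $C_1,C_2>0$, independent of the mesh size $h$, such that the following two conditions hold for all grids $\mathcal T_h$ of the family. (1) (K-ellipticity) $(A\tau,\tau)\ge C_1\|\tau\|_{H(\operatorname{div}_h)}^2$ for all $\tau\in Z_h$, where $Z_h=\{\tau_h\in\Sigma_h : (\operatorname{div}_h\tau_h,v)=0\ \ \forall v\in V_h\}$. (2) (Discrete B-B condition) $$\inf_{0\ne v\in V_h}\ \sup_{0\ne\tau\in\Sigma_h}\frac{(\operatorname{div}_h\tau,v)}{\|\tau\|_{H(\operatorname{div}_h)}\,\|v\|_0}\ \ge\ C_2 .$$ Consequently, the discrete mixed problem: find $(\sigma_h,u_h)\in\Sigma_h\times V_h$ such that $$(A\sigma_h,\tau)+(\operatorname{div}_h\tau,u_h)=0\quad\forall\tau\in\Sigma_h,\qquad (\operatorname{div}_h\sigma_h,v)=(f,v)\quad\forall v\in V_h,$$ has a unique solution $(\sigma_h,u_h)\in\Sigma_h\times V_h$.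
   Context: Let $\Omega\subset\mathbb R^2$ be a rectangle with sides parallel to the coordinate axes, and $f\in L^2(\Omega,\mathbb R^2)$. $\mathbb S$ denotes the symmetric $2\times2$ real matrices; $(\cdot,\cdot)$ and $\|\cdot\|_0$ are the $L^2(\Omega)$ inner product and norm for scalar, vector (Euclidean product) or matrix (Frobenius product) valued functions. $A$ is the (bounded) symmetric and (uniformly) positive definite operator acting on $\mathbb S$-valued functions on $\Omega$ (compliance tensor). $\{\mathcal T_h\}$ is a family of rectangular grids of $\Omega$: each $\mathcal T_h$ is a conforming partition of $\Omega$ into rectangles $K$ with sides parallel to the axes, and $h$ is the mesh size (maximal side length). Edges are horizontal or vertical; an edge is interior if it is not contained in $\partial\Omega$. On each $K$ let $V_K=P_0(K)^2$ (constant vectors), and let $\Sigma_K$ be the set of symmetric matrix functions $\begin{pmatrix}\sigma_{11}&\sigma_{12}\\ \sigma_{12}&\sigma_{22}\end{pmatrix}$ on $K$ with $\sigma_{11}\in\operatorname{span}\{1,x\}$, $\sigma_{22}\in\operatorname{span}\{1,y\}$, $\sigma_{12}\in\operatorname{span}\{1,x,y\}$. Define - $\Sigma_h$: the set of $\sigma\in L^2(\Omega,\mathbb S)$ with $\sigma|_K\in\Sigma_K$ for all $K\in\mathcal T_h$, such that $\sigma_{11}$ is continuous across all vertical interior edges, $\sigma_{22}$ is continuous across all horizontal interior edges, and $\sigma_{12}$ is continuous at the midpoints of all interior edges; - $V_h=\{v\in L^2(\Omega,\mathbb R^2): v|_K\in V_K\ \forall K\in\mathcal T_h\}$. $\operatorname{div}_h$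 is the elementwise (row-wise) divergence, $(\operatorname{div}_h\tau)|_K=\operatorname{div}(\tau|_K)$, and $\|\tau\|_{H(\operatorname{div}_h)}=(\|\tau\|_0^2+\|\operatorname{div}_h\tau\|_0^2)^{1/2}$. *)

theory Defs
  imports "HOL-Analysis.Analysis"
begin

text \<open>Points of the plane are elements of \<open>real^2\<close> with coordinates \<open>x = z$1\<close>, \<open>y = z$2\<close>;
  matrices are elements of \<open>real^2^2\<close>, on which the library inner product \<open>\<bullet>\<close> is the Frobenius
  product and \<open>norm\<close> is the Frobenius norm.\<close>

section \<open>Square integrable functions\<close>

text \<open>Elements of \<open>L\<^sup>2\<close> are represented by functions on the plane of which only the
  values on \<open>\<Omega>\<close> matter; equality in \<open>L\<^sup>2\<close> is equality almost everywhere on \<open>\<Omega>\<close>.\<close>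

definition L2 :: "(real^2) set \<Rightarrow> (real^2 \<Rightarrow> 'a::euclidean_space) set" where
  "L2 \<Omega> = {g. g \<in> borel_measurable (lebesgue_on \<Omega>) \<and>
              integrable (lebesgue_on \<Omega>) (\<lambda>z. (norm (g z))\<^sup>2)}"

definition L2_eq :: "(real^2) set \<Rightarrow> (real^2 \<Rightarrow> 'a::euclidean_space) \<Rightarrow> (real^2 \<Rightarrow> 'a) \<Rightarrow> bool" where
  "L2_eq \<Omega> g k \<longleftrightarrow> (AE z in lebesgue_on \<Omega>. g z = k z)"

definition L2_inner :: "(real^2) set \<Rightarrow> (real^2 \<Rightarrow> 'a::euclidean_space) \<Rightarrow> (real^2 \<Rightarrow> 'a) \<Rightarrow> real" where
  "L2_inner \<Omega> g k = integral\<^sup>L (lebesgue_on \<Omega>) (\<lambda>z. g z \<bullet> k z)"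

definition L2_norm :: "(real^2) set \<Rightarrow> (real^2 \<Rightarrow> 'a::euclidean_space) \<Rightarrow> real" where
  "L2_norm \<Omega> g = sqrt (L2_inner \<Omega> g g)"

definition L2_sym :: "(real^2) set \<Rightarrow> (real^2 \<Rightarrow> real^2^2) set" where
  "L2_sym \<Omega> = {\<tau> \<in> L2 \<Omega>. AE z in lebesgue_on \<Omega>. transpose (\<tau> z) = \<tau> z}"

section \<open>The compliance operator\<close>

text \<open>A bounded, symmetric, uniformly positive definite linear operator on \<open>L\<^sup>2(\<Omega>,\<bbbS>)\<close>.
  Linearity is required almost everywhere; together with boundedness it makes \<open>A\<close> well defined on
  classes of almost everywhere equal functions.\<close>

definition compliance_operator ::
    "(real^2) set \<Rightarrow> ((real^2 \<Rightarrow> real^2^2) \<Rightarrow> (real^2 \<Rightarrow> real^2^2)) \<Rightarrow> bool" where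
  "compliance_operator \<Omega> A \<longleftrightarrow>
     (\<forall>\<tau>\<in>L2_sym \<Omega>. A \<tau> \<in> L2_sym \<Omega>) \<and>
     (\<forall>\<sigma>\<in>L2_sym \<Omega>. \<forall>\<tau>\<in>L2_sym \<Omega>. \<forall>a b.
        L2_eq \<Omega> (A (\<lambda>z. a *\<^sub>R \<sigma> z + b *\<^sub>R \<tau> z)) (\<lambda>z. a *\<^sub>R A \<sigma> z + b *\<^sub>R A \<tau> z)) \<and>
     (\<exists>M. \<forall>\<tau>\<in>L2_sym \<Omega>. L2_norm \<Omega> (A \<tau>) \<le> M * L2_norm \<Omega> \<tau>) \<and>
     (\<forall>\<sigma>\<in>L2_sym \<Omega>. \<forall>\<tau>\<in>L2_sym \<Omega>. L2_inner \<Omega> (A \<sigma>) \<tau> = L2_inner \<Omega> \<sigma> (A \<tau>)) \<and>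
     (\<exists>\<alpha>>0. \<forall>\<tau>\<in>L2_sym \<Omega>. L2_inner \<Omega> (A \<tau>) \<tau> \<ge> \<alpha> * (L2_norm \<Omega> \<tau>)\<^sup>2)"

text \<open>A pointwise tensor field \<open>C(z)\<close> that is measurable, bounded, symmetric and uniformly
  positive definite on symmetric matrices induces such an operator.\<close>

lemma compliance_tensor_is_compliance_operator:
  fixes C :: "real^2 \<Rightarrow> real^2^2 \<Rightarrow> real^2^2"
  assumes lin: "\<And>z. z \<in> \<Omega> \<Longrightarrow> linear (C z)"
    and meas: "\<And>S. (\<lambda>z. C z S) \<in> borel_measurable (lebesgue_on \<Omega>)"
    and pres: "\<And>z S. z \<in> \<Omega> \<Longrightarrow> transpose S = S \<Longrightarrow> transpose (C z S) = C z S"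
    and bdd: "\<And>z S. z \<in> \<Omega> \<Longrightarrow> transpose S = S \<Longrightarrow> norm (C z S) \<le> M * norm S"
    and symm: "\<And>z S T. z \<in> \<Omega> \<Longrightarrow> transpose S = S \<Longrightarrow> transpose T = T \<Longrightarrow> C z S \<bullet> T = S \<bullet> C z T"
    and pos: "\<alpha> > 0" "\<And>z S. z \<in> \<Omega> \<Longrightarrow> transpose S = S \<Longrightarrow> C z S \<bullet> S \<ge> \<alpha> * (norm S)\<^sup>2"
  shows "compliance_operator \<Omega> (\<lambda>\<tau> z. C z (\<tau> z))"
proof -
  let ?L = "lebesgue_on \<Omega>"
  have sp: "z \<in> space ?L \<Longrightarrow> z \<in> \<Omega>" for z by (simp add: space_restrict_space)
  have mono: "AE z in ?L. P z"
    if "AE z in ?L. transpose (\<tau> z) = \<tau> z" "\<And>z. z \<in> \<Omega> \<Longrightarrow> transpose (\<tau> z) = \<tau> z \<Longrightarrow> P z"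
    for P and \<tau> :: "real^2 \<Rightarrow> real^2^2"
    using that(1) AE_space by eventually_elim (use that(2) sp in blast)
  have mC: "(\<lambda>z. C z (\<tau> z)) \<in> borel_measurable ?L" if "\<tau> \<in> borel_measurable ?L"
    for \<tau> :: "real^2 \<Rightarrow> real^2^2"
  proof -
    have "(\<lambda>z. \<Sum>B\<in>Basis. (\<tau> z \<bullet> B) *\<^sub>R C z B) \<in> borel_measurable ?L"
      using that meas by (intro borel_measurable_sum borel_measurable_scaleR) auto
    moreover have "(\<Sum>B\<in>Basis. (\<tau> z \<bullet> B) *\<^sub>R C z B) = C z (\<tau> z)" if "z \<in> \<Omega>" for z
    proof -
      have "C z (\<tau> z) = C z (\<Sum>B\<in>Basis. (\<tau> z \<bullet> B) *\<^sub>R B)" by (simp add: euclidean_representation)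
      then show ?thesis
        using lin[OF that] by (simp add: linear_sum linear_cmul)
    qed
    ultimately show ?thesis
      by (subst measurable_cong[where g = "\<lambda>z. \<Sum>B\<in>Basis. (\<tau> z \<bullet> B) *\<^sub>R C z B"]) (auto dest: sp)
  qed
  have L2D: "\<tau> \<in> borel_measurable ?L" "integrable ?L (\<lambda>z. (norm (\<tau> z))\<^sup>2)"
      "AE z in ?L. transpose (\<tau> z) = \<tau> z" if "\<tau> \<in> L2_sym \<Omega>" for \<tau>
    using that by (auto simp: L2_sym_def L2_def)
  have sq: "(norm (C z S))\<^sup>2 \<le> M\<^sup>2 * (norm S)\<^sup>2" if "z \<in> \<Omega>" "transpose S = S" for z S
    using power_mono[OF bdd[OF that], of 2] by (simp add: power_mult_distrib)
  have int: "integrable ?L (\<lambda>z. (norm (C z (\<tau> z)))\<^sup>2)" if "\<tau> \<in> L2_sym \<Omega>" for \<tau>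
  proof (rule Bochner_Integration.integrable_bound)
    show "integrable ?L (\<lambda>z. M\<^sup>2 * (norm (\<tau> z))\<^sup>2)" using L2D[OF that] by simp
    show "(\<lambda>z. (norm (C z (\<tau> z)))\<^sup>2) \<in> borel_measurable ?L"
      using mC[OF L2D(1)[OF that]] by measurable
    show "AE z in ?L. norm ((norm (C z (\<tau> z)))\<^sup>2) \<le> norm (M\<^sup>2 * (norm (\<tau> z))\<^sup>2)"
      by (rule mono[OF L2D(3)[OF that]]) (simp add: sq)
  qed
  have mem: "(\<lambda>z. C z (\<tau> z)) \<in> L2_sym \<Omega>" if "\<tau> \<in> L2_sym \<Omega>" for \<tau>
    using mC[OF L2D(1)[OF that]] int[OF that] mono[OF L2D(3)[OF that], OF pres]
    by (simp add: L2_sym_def L2_def)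
  have nrm: "(L2_norm \<Omega> \<tau>)\<^sup>2 = integral\<^sup>L ?L (\<lambda>z. (norm (\<tau> z))\<^sup>2)" for \<tau> :: "real^2 \<Rightarrow> real^2^2"
    by (simp add: L2_norm_def L2_inner_def power2_norm_eq_inner)
  have bound: "L2_norm \<Omega> (\<lambda>z. C z (\<tau> z)) \<le> \<bar>M\<bar> * L2_norm \<Omega> \<tau>" if "\<tau> \<in> L2_sym \<Omega>" for \<tau>
  proof (rule power2_le_imp_le)
    have "(L2_norm \<Omega> (\<lambda>z. C z (\<tau> z)))\<^sup>2 \<le> integral\<^sup>L ?L (\<lambda>z. M\<^sup>2 * (norm (\<tau> z))\<^sup>2)"
      unfolding nrm using L2D(2)[OF that] int[OF that]
      by (intro integral_mono_AE mono[OF L2D(3)[OF that]]) (auto simp: sq)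
    also have "\<dots> = (\<bar>M\<bar> * L2_norm \<Omega> \<tau>)\<^sup>2"
      by (simp add: nrm power_mult_distrib)
    finally show "(L2_norm \<Omega> (\<lambda>z. C z (\<tau> z)))\<^sup>2 \<le> (\<bar>M\<bar> * L2_norm \<Omega> \<tau>)\<^sup>2" .
    show "0 \<le> \<bar>M\<bar> * L2_norm \<Omega> \<tau>"
      by (simp add: L2_norm_def L2_inner_def integral_nonneg_AE)
  qed
  have self: "L2_inner \<Omega> (\<lambda>z. C z (\<sigma> z)) \<tau> = L2_inner \<Omega> \<sigma> (\<lambda>z. C z (\<tau> z))"
    if "\<sigma> \<in> L2_sym \<Omega>" "\<tau> \<in> L2_sym \<Omega>" for \<sigma> \<tau>
  proof -
    have "AE z in ?L. C z (\<sigma> z) \<bullet> \<tau> z = \<sigma> z \<bullet> C z (\<tau> z)"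
      using L2D(3)[OF that(1)] L2D(3)[OF that(2)] AE_space by eventually_elim (use symm sp in blast)
    then show ?thesis unfolding L2_inner_def
      using mC[OF L2D(1)[OF that(1)]] mC[OF L2D(1)[OF that(2)]] L2D(1)[OF that(1)] L2D(1)[OF that(2)]
      by (intro integral_cong_AE) auto
  qed
  have ell: "L2_inner \<Omega> (\<lambda>z. C z (\<tau> z)) \<tau> \<ge> \<alpha> * (L2_norm \<Omega> \<tau>)\<^sup>2" if "\<tau> \<in> L2_sym \<Omega>" for \<tau>
  proof -
    have "integrable ?L (\<lambda>z. C z (\<tau> z) \<bullet> \<tau> z)"
    proof (rule Bochner_Integration.integrable_bound)
      show "integrable ?L (\<lambda>z. (norm (C z (\<tau> z)))\<^sup>2 + (norm (\<tau> z))\<^sup>2)"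
        using int[OF that] L2D(2)[OF that] by simp
      show "(\<lambda>z. C z (\<tau> z) \<bullet> \<tau> z) \<in> borel_measurable ?L"
        using mC[OF L2D(1)[OF that]] L2D(1)[OF that] by measurable
      have "\<bar>S \<bullet> T\<bar> \<le> (norm S)\<^sup>2 + (norm T)\<^sup>2" for S T :: "real^2^2"
      proof -
        have "2 * (norm S * norm T) \<le> (norm S)\<^sup>2 + (norm T)\<^sup>2"
          using sum_squares_bound[of "norm S" "norm T"] by simp
        moreover have "0 \<le> norm S * norm T" by simp
        ultimately show ?thesis using Cauchy_Schwarz_ineq2[of S T] by linarith
      qed
      then show "AE z in ?L. norm (C z (\<tau> z) \<bullet> \<tau> z) \<le> norm ((norm (C z (\<tau> z)))\<^sup>2 + (norm (\<tau> z))\<^sup>2)"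
        by simp
    qed
    then have "integral\<^sup>L ?L (\<lambda>z. \<alpha> * (norm (\<tau> z))\<^sup>2) \<le> L2_inner \<Omega> (\<lambda>z. C z (\<tau> z)) \<tau>"
      unfolding L2_inner_def using L2D(2)[OF that]
      by (intro integral_mono_AE mono[OF L2D(3)[OF that]]) (auto intro: pos(2))
    then show ?thesis by (simp add: nrm)
  qed
  have "L2_eq \<Omega> (\<lambda>z. C z (a *\<^sub>R \<sigma> z + b *\<^sub>R \<tau> z)) (\<lambda>z. a *\<^sub>R C z (\<sigma> z) + b *\<^sub>R C z (\<tau> z))" for \<sigma> \<tau> a b
    unfolding L2_eq_def by (rule AE_I2) (simp add: linear_add[OF lin] linear_cmul[OF lin] sp)
  then show ?thesis
    unfolding compliance_operator_def using mem bound self ell pos(1) by blast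
qed

section \<open>Rectangular grids\<close>

definition is_rectangle :: "(real^2) set \<Rightarrow> bool" where
  "is_rectangle K \<longleftrightarrow> (\<exists>a b. a$1 < b$1 \<and> a$2 < b$2 \<and> K = cbox a b)"

text \<open>The grid is conforming: two elements meet in a common face (the empty set, a vertex, an edge,
  or the whole element if they coincide).\<close>

definition rectangular_grid :: "(real^2) set \<Rightarrow> (real^2) set set \<Rightarrow> bool" where
  "rectangular_grid \<Omega> \<T> \<longleftrightarrow>
     \<T> division_of \<Omega> \<and> (\<forall>K\<in>\<T>. is_rectangle K) \<and>
     (\<forall>K\<in>\<T>. \<forall>L\<in>\<T>. (K \<inter> L) face_of K \<and> (K \<inter> L) face_of L)"

definition interior_edges :: "(real^2) set \<Rightarrow> (real^2) set set \<Rightarrow> (real^2) set set" where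
  "interior_edges \<Omega> \<T> = {e. (\<exists>K\<in>\<T>. e edge_of K) \<and> \<not> e \<subseteq> frontier \<Omega>}"

definition vertical :: "(real^2) set \<Rightarrow> bool" where
  "vertical e \<longleftrightarrow> (\<exists>c. \<forall>z\<in>e. z$1 = c)"

definition horizontal :: "(real^2) set \<Rightarrow> bool" where
  "horizontal e \<longleftrightarrow> (\<exists>c. \<forall>z\<in>e. z$2 = c)"

text \<open>Continuity of a piecewise smooth function across the edge \<open>e\<close> at its point \<open>z\<close>: the
  traces at \<open>z\<close> taken from the elements that share \<open>e\<close> coincide. The values of \<open>g\<close> on the edge
  itself are irrelevant.\<close>

definition continuous_across ::
    "(real^2) set set \<Rightarrow> (real^2 \<Rightarrow> real) \<Rightarrow> (real^2) set \<Rightarrow> real^2 \<Rightarrow> bool" where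
  "continuous_across \<T> g e z \<longleftrightarrow>
     (\<exists>l. \<forall>K\<in>\<T>. e \<subseteq> K \<longrightarrow> (g \<longlongrightarrow> l) (at z within interior K))"

section \<open>Finite element spaces\<close>

definition Sigma_loc :: "(real^2 \<Rightarrow> real^2^2) set" where
  "Sigma_loc = {\<tau>. \<exists>a0 a1 b0 b1 c0 c1 c2. \<forall>z.
     \<tau> z = vector [vector [a0 + a1 * z$1, c0 + c1 * z$1 + c2 * z$2],
                   vector [c0 + c1 * z$1 + c2 * z$2, b0 + b1 * z$2]]}"

text \<open>Restrictions to an element are read on its interior, so that the values on the (null) set of
  element boundaries are left free.\<close>

definition Sigma_h :: "(real^2) set \<Rightarrow> (real^2) set set \<Rightarrow> (real^2 \<Rightarrow> real^2^2) set" where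
  "Sigma_h \<Omega> \<T> = {\<sigma> \<in> L2_sym \<Omega>.
     (\<forall>K\<in>\<T>. \<exists>p\<in>Sigma_loc. \<forall>z\<in>interior K. \<sigma> z = p z) \<and>
     (\<forall>e\<in>interior_edges \<Omega> \<T>. vertical e \<longrightarrow>
        (\<forall>z\<in>e. continuous_across \<T> (\<lambda>w. \<sigma> w $ 1 $ 1) e z)) \<and>
     (\<forall>e\<in>interior_edges \<Omega> \<T>. horizontal e \<longrightarrow>
        (\<forall>z\<in>e. continuous_across \<T> (\<lambda>w. \<sigma> w $ 2 $ 2) e z)) \<and>
     (\<forall>p q. closed_segment p q \<in> interior_edges \<Omega> \<T> \<longrightarrow>
        continuous_across \<T> (\<lambda>w. \<sigma> w $ 1 $ 2) (closed_segment p q) (midpoint p q))}"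

definition V_h :: "(real^2) set \<Rightarrow> (real^2) set set \<Rightarrow> (real^2 \<Rightarrow> real^2) set" where
  "V_h \<Omega> \<T> = {v \<in> L2 \<Omega>. \<forall>K\<in>\<T>. \<exists>c. \<forall>z\<in>interior K. v z = c}"

definition divergence :: "(real^2 \<Rightarrow> real^2^2) \<Rightarrow> real^2 \<Rightarrow> real^2" where
  "divergence \<tau> z = (\<chi> i. \<Sum>j\<in>UNIV. frechet_derivative (\<lambda>w. \<tau> w $ i $ j) (at z) (axis j 1))"

definition div_h :: "(real^2) set set \<Rightarrow> (real^2 \<Rightarrow> real^2^2) \<Rightarrow> real^2 \<Rightarrow> real^2" where
  "div_h \<T> \<tau> z = (if \<exists>K\<in>\<T>. z \<in> interior K then divergence \<tau> z else 0)"

definition Hdiv_norm :: "(real^2) set \<Rightarrow> (real^2) set set \<Rightarrow> (real^2 \<Rightarrow> real^2^2) \<Rightarrow> real" where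
  "Hdiv_norm \<Omega> \<T> \<tau> = sqrt ((L2_norm \<Omega> \<tau>)\<^sup>2 + (L2_norm \<Omega> (div_h \<T> \<tau>))\<^sup>2)"

definition Z_h :: "(real^2) set \<Rightarrow> (real^2) set set \<Rightarrow> (real^2 \<Rightarrow> real^2^2) set" where
  "Z_h \<Omega> \<T> = {\<tau> \<in> Sigma_h \<Omega> \<T>. \<forall>v\<in>V_h \<Omega> \<T>. L2_inner \<Omega> (div_h \<T> \<tau>) v = 0}"

section \<open>Stability conditions and the discrete problem\<close>

definition K_ellipticity ::
    "(real^2) set \<Rightarrow> ((real^2 \<Rightarrow> real^2^2) \<Rightarrow> (real^2 \<Rightarrow> real^2^2)) \<Rightarrow> (real^2) set set \<Rightarrow> real \<Rightarrow> bool" where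
  "K_ellipticity \<Omega> A \<T> C \<longleftrightarrow>
     (\<forall>\<tau>\<in>Z_h \<Omega> \<T>. L2_inner \<Omega> (A \<tau>) \<tau> \<ge> C * (Hdiv_norm \<Omega> \<T> \<tau>)\<^sup>2)"

text \<open>The infimum and supremum are taken in the extended reals, where they are always defined.\<close>

definition inf_sup :: "(real^2) set \<Rightarrow> (real^2) set set \<Rightarrow> ereal" where
  "inf_sup \<Omega> \<T> =
     (INF v\<in>{v \<in> V_h \<Omega> \<T>. \<not> L2_eq \<Omega> v (\<lambda>_. 0)}.
      SUP \<tau>\<in>{\<tau> \<in> Sigma_h \<Omega> \<T>. \<not> L2_eq \<Omega> \<tau> (\<lambda>_. 0)}.
        ereal (L2_inner \<Omega> (div_h \<T> \<tau>) v / (Hdiv_norm \<Omega> \<T> \<tau> * L2_norm \<Omega> v)))"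

definition mixed_solution ::
    "(real^2) set \<Rightarrow> ((real^2 \<Rightarrow> real^2^2) \<Rightarrow> (real^2 \<Rightarrow> real^2^2)) \<Rightarrow> (real^2 \<Rightarrow> real^2) \<Rightarrow>
     (real^2) set set \<Rightarrow> (real^2 \<Rightarrow> real^2^2) \<Rightarrow> (real^2 \<Rightarrow> real^2) \<Rightarrow> bool" where
  "mixed_solution \<Omega> A f \<T> \<sigma> u \<longleftrightarrow>
     \<sigma> \<in> Sigma_h \<Omega> \<T> \<and> u \<in> V_h \<Omega> \<T> \<and>
     (\<forall>\<tau>\<in>Sigma_h \<Omega> \<T>. L2_inner \<Omega> (A \<sigma>) \<tau> + L2_inner \<Omega> (div_h \<T> \<tau>) u = 0) \<and>
     (\<forall>v\<in>V_h \<Omega> \<T>. L2_inner \<Omega> (div_h \<T> \<sigma>) v = L2_inner \<Omega> f v)"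

end

theory Submission
  imports Defs
begin

text \<open>Both stability conditions rest on the inclusion \<open>div\<^sub>h \<Sigma>\<^sub>h \<subseteq> V\<^sub>h\<close> and on an explicit right inverse of
  \<open>div\<^sub>h\<close>. Because of the inclusion, an element of \<open>Z\<^sub>h\<close> has zero divergence (\<open>Z_h_div_free\<close>), so on \<open>Z\<^sub>h\<close> the
  \<open>H(div\<^sub>h)\<close> norm is the \<open>L\<^sup>2\<close> norm and ellipticity holds with the ellipticity constant of \<open>A\<close>.

  For \<open>v \<in> V\<^sub>h\<close> let \<open>stress v\<close> be the diagonal field with \<open>\<sigma>\<^sub>1\<^sub>1 = \<integral> v\<^sub>1 dx\<close> and \<open>\<sigma>\<^sub>2\<^sub>2 = \<integral> v\<^sub>2 dy\<close>, integrated from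
  the boundary. Its divergence is \<open>v\<close>, and one-dimensional Cauchy-Schwarz bounds its \<open>L\<^sup>2\<close> norm by \<open>D \<parallel>v\<parallel>\<close> with
  \<open>D\<close> the diameter of \<open>\<Omega>\<close> (\<open>stress_bound\<close>). This gives the inf-sup constant \<open>1 / sqrt (D\<^sup>2 + 1)\<close> for every grid
  (\<open>inf_sup_bound\<close>). That the field belongs to \<open>\<Sigma>\<^sub>h\<close> uses that a conforming partition of a rectangle is a tensor
  product grid (\<open>overlap_imp_same_range\<close>): in each element the integral of \<open>v\<^sub>1\<close> along \<open>x\<close> does not depend on
  \<open>y\<close>, and it has no jump across vertical edges.

  Unique solvability (\<open>mixed_problem\<close>) is then linear algebra. The projection of \<open>f\<close> to \<open>V\<^sub>h\<close>, the correction of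
  \<open>stress\<close> of that projection by an element of \<open>Z\<^sub>h\<close>, and the multiplier \<open>u\<^sub>h\<close> are all obtained from a Riesz
  representation lemma (\<open>riesz_finite_dimensional\<close>).\<close>

section \<open>Linear functionals on finite-dimensional spaces of functions\<close>

text \<open>A space of functions is a set of functions closed under pointwise linear combinations. Functions
  are not identified here when they agree almost everywhere; the bilinear forms below are therefore only
  semidefinite.\<close>

definition fun_subspace :: "('x \<Rightarrow> 'v::real_vector) set \<Rightarrow> bool" where
  "fun_subspace Z \<longleftrightarrow> Z \<noteq> {} \<and> (\<forall>f\<in>Z. \<forall>g\<in>Z. \<forall>a b. (\<lambda>x. a *\<^sub>R f x + b *\<^sub>R g x) \<in> Z)"

text \<open>Only the restriction of \<open>\<phi>\<close> to the space \<open>Z\<close> matters.\<close>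

definition linear_functional :: "('x \<Rightarrow> 'v::real_vector) set \<Rightarrow> (('x \<Rightarrow> 'v) \<Rightarrow> real) \<Rightarrow> bool" where
  "linear_functional Z \<phi> \<longleftrightarrow>
     (\<forall>f\<in>Z. \<forall>g\<in>Z. \<forall>a b. \<phi> (\<lambda>x. a *\<^sub>R f x + b *\<^sub>R g x) = a * \<phi> f + b * \<phi> g)"

lemma fun_subspaceD:
  "fun_subspace Z \<Longrightarrow> f \<in> Z \<Longrightarrow> g \<in> Z \<Longrightarrow> (\<lambda>x. a *\<^sub>R f x + b *\<^sub>R g x) \<in> Z"
  unfolding fun_subspace_def by blast

lemma fun_subspace_zero: "fun_subspace Z \<Longrightarrow> (\<lambda>x. 0) \<in> Z"
proof -
  assume *: "fun_subspace Z"
  then obtain f where "f \<in> Z" unfolding fun_subspace_def by blast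
  from fun_subspaceD[OF * this this, of 0 0] show ?thesis by simp
qed

lemma linear_functionalD:
  "linear_functional Z \<phi> \<Longrightarrow> f \<in> Z \<Longrightarrow> g \<in> Z \<Longrightarrow>
    \<phi> (\<lambda>x. a *\<^sub>R f x + b *\<^sub>R g x) = a * \<phi> f + b * \<phi> g"
  unfolding linear_functional_def by blast

lemma linear_functional_subset:
  "linear_functional Z \<phi> \<Longrightarrow> Y \<subseteq> Z \<Longrightarrow> linear_functional Y \<phi>"
  unfolding linear_functional_def by blast

lemma linear_functional_zero:
  assumes "fun_subspace Z" "linear_functional Z \<phi>" shows "\<phi> (\<lambda>x. 0) = 0"
  using linear_functionalD[OF assms(2) fun_subspace_zero[OF assms(1)] fun_subspace_zero[OF assms(1)], of 0 0]
  by simp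

text \<open>Riesz representation for a semidefinite form \<open>B\<close>. Finite dimensionality modulo the null space
  of \<open>B\<close> is expressed by finitely many linear functionals whose common kernel consists of null vectors;
  the proof adds one functional at a time and splits off the orthogonal complement of its kernel.\<close>

lemma riesz_finite_dimensional:
  fixes Z :: "('x \<Rightarrow> 'v::real_vector) set"
  assumes "finite F" and Z: "fun_subspace Z"
    and F: "\<And>l. l \<in> F \<Longrightarrow> linear_functional Z l"
    and sep: "\<And>f. f \<in> Z \<Longrightarrow> (\<And>l. l \<in> F \<Longrightarrow> l f = 0) \<Longrightarrow> B f f = 0"
    and lin: "\<And>f. f \<in> Z \<Longrightarrow> linear_functional Z (B f)"
    and sym: "\<And>f g. f \<in> Z \<Longrightarrow> g \<in> Z \<Longrightarrow> B f g = B g f"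
    and null: "\<And>f g. f \<in> Z \<Longrightarrow> g \<in> Z \<Longrightarrow> B g g = 0 \<Longrightarrow> B f g = 0"
    and \<phi>: "linear_functional Z \<phi>" and \<phi>_null: "\<And>g. g \<in> Z \<Longrightarrow> B g g = 0 \<Longrightarrow> \<phi> g = 0"
  shows "\<exists>p\<in>Z. \<forall>z\<in>Z. B p z = \<phi> z"
  using assms
proof (induction F arbitrary: Z \<phi> rule: finite_induct)
  case empty
  then show ?case using fun_subspace_zero[OF empty.prems(1)] by (metis empty_iff)
next
  case (insert l F)
  note Z = insert.prems(1) and lin = insert.prems(4) and sym = insert.prems(5)
    and null = insert.prems(6) and \<phi> = insert.prems(7) and \<phi>_null = insert.prems(8)
  have l: "linear_functional Z l" using insert.prems(2) by simp
  define Y where "Y = {z \<in> Z. l z = 0}"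
  have YZ: "Y \<subseteq> Z" by (auto simp: Y_def)
  have Y: "fun_subspace Y"
    using fun_subspace_zero[OF Z] linear_functional_zero[OF Z l] fun_subspaceD[OF Z] linear_functionalD[OF l]
    unfolding fun_subspace_def Y_def by auto
  have IH: "\<exists>p\<in>Y. \<forall>z\<in>Y. B p z = \<psi> z"
    if "linear_functional Z \<psi>" "\<And>g. g \<in> Z \<Longrightarrow> B g g = 0 \<Longrightarrow> \<psi> g = 0" for \<psi>
  proof (rule insert.IH[OF Y])
    show "linear_functional Y m" if "m \<in> F" for m
      using insert.prems(2) that linear_functional_subset[OF _ YZ] by blast
    show "B f f = 0" if "f \<in> Y" "\<And>m. m \<in> F \<Longrightarrow> m f = 0" for f
      using insert.prems(3)[of f] that by (auto simp: Y_def)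
    show "linear_functional Y (B f)" if "f \<in> Y" for f
      using lin that YZ linear_functional_subset[OF _ YZ] by blast
    show "linear_functional Y \<psi>" using that(1) linear_functional_subset[OF _ YZ] by blast
    show "B f g = B g f" if "f \<in> Y" "g \<in> Y" for f g
      using sym that YZ by blast
    show "B f g = 0" if "f \<in> Y" "g \<in> Y" "B g g = 0" for f g
      using null that YZ by blast
    show "\<psi> g = 0" if "g \<in> Y" "B g g = 0" for g
      using \<open>\<And>g. g \<in> Z \<Longrightarrow> B g g = 0 \<Longrightarrow> \<psi> g = 0\<close> that YZ by blast
  qed
  obtain p where p: "p \<in> Y" "\<And>z. z \<in> Y \<Longrightarrow> B p z = \<phi> z"
    using IH[OF \<phi> \<phi>_null] by blast
  show ?case
  proof (cases "Y = Z")
    case True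
    then show ?thesis using p by blast
  next
    case False
    then obtain w where w: "w \<in> Z" "l w \<noteq> 0" using YZ by (auto simp: Y_def)
    obtain q where q: "q \<in> Y" "\<And>z. z \<in> Y \<Longrightarrow> B q z = B w z"
      using IH[OF lin[OF w(1)] null[OF w(1)]] by blast
    \<comment> \<open>\<open>g\<close> is \<open>B\<close>-orthogonal to \<open>Y\<close> and spans \<open>Z\<close> together with \<open>Y\<close>.\<close>
    define g where "g = (\<lambda>x. 1 *\<^sub>R w x + (-1) *\<^sub>R q x)"
    have qZ: "q \<in> Z" and pZ: "p \<in> Z" using q p YZ by auto
    have g: "g \<in> Z" unfolding g_def by (rule fun_subspaceD[OF Z w(1) qZ])
    have lg: "l g = l w"
      using linear_functionalD[OF l w(1) qZ, of 1 "-1"] q(1) by (simp add: g_def Y_def)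
    have gY: "B z g = 0" if "z \<in> Y" for z
    proof -
      have "z \<in> Z" using that YZ by auto
      then have "B z g = B z w - B z q"
        using linear_functionalD[OF lin[of z] w(1) qZ, of 1 "-1"] by (simp add: g_def)
      also have "\<dots> = 0" using q(2)[OF that] sym \<open>z \<in> Z\<close> w(1) qZ by simp
      finally show ?thesis .
    qed
    \<comment> \<open>If \<open>g\<close> is a null vector, then \<open>p\<close> needs no correction.\<close>
    define s where "s = (if B g g = 0 then 0 else \<phi> g / B g g)"
    have s: "s * B g g = \<phi> g" using \<phi>_null[OF g] by (simp add: s_def)
    define r where "r = (\<lambda>x. 1 *\<^sub>R p x + s *\<^sub>R g x)"
    have r: "r \<in> Z" unfolding r_def by (rule fun_subspaceD[OF Z pZ g])
    have "B r z = \<phi> z" if z: "z \<in> Z" for z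
    proof -
      define t where "t = l z / l w"
      define y where "y = (\<lambda>x. 1 *\<^sub>R z x + (- t) *\<^sub>R g x)"
      have yZ: "y \<in> Z" unfolding y_def by (rule fun_subspaceD[OF Z z g])
      have "l y = 0"
        using linear_functionalD[OF l z g, of 1 "-t"] w(2) by (simp add: y_def lg t_def)
      then have y: "y \<in> Y" using yZ by (simp add: Y_def)
      have zy: "z = (\<lambda>x. 1 *\<^sub>R y x + t *\<^sub>R g x)" by (auto simp: y_def)
      have Br: "B r v = B p v + s * B g v" if "v \<in> Z" for v
      proof -
        have "B r v = B v r" using sym r that by simp
        also have "\<dots> = B v p + s * B v g"
          using linear_functionalD[OF lin[OF that] pZ g, of 1 s] by (simp add: r_def)
        finally show ?thesis using sym that pZ g by simp
      qed
      have "B r z = B r y + t * B r g"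
        using linear_functionalD[OF lin[OF r] yZ g, of 1 t] unfolding zy[symmetric] by simp
      also have "\<dots> = \<phi> y + t * \<phi> g"
        using Br[OF yZ] Br[OF g] p(2)[OF y] gY[OF y] gY[OF p(1)] s sym[OF g yZ] by simp
      also have "\<dots> = \<phi> z"
        using linear_functionalD[OF \<phi> yZ g, of 1 t] unfolding zy[symmetric] by simp
      finally show ?thesis .
    qed
    then show ?thesis using r by blast
  qed
qed

section \<open>Square integrable functions\<close>

lemma L2_integrable_inner:
  assumes "f \<in> L2 \<Omega>" "g \<in> L2 \<Omega>"
  shows "integrable (lebesgue_on \<Omega>) (\<lambda>z. f z \<bullet> g z)"
proof (rule Bochner_Integration.integrable_bound)
  show "integrable (lebesgue_on \<Omega>) (\<lambda>z. (norm (f z))\<^sup>2 + (norm (g z))\<^sup>2)"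
    using assms by (simp add: L2_def)
  have "f \<in> borel_measurable (lebesgue_on \<Omega>)" "g \<in> borel_measurable (lebesgue_on \<Omega>)"
    using assms by (simp_all add: L2_def)
  then show "(\<lambda>z. f z \<bullet> g z) \<in> borel_measurable (lebesgue_on \<Omega>)" by measurable
  have "\<bar>s \<bullet> t\<bar> \<le> (norm s)\<^sup>2 + (norm t)\<^sup>2" for s t :: 'a
  proof -
    have "2 * (norm s * norm t) \<le> (norm s)\<^sup>2 + (norm t)\<^sup>2"
      using sum_squares_bound[of "norm s" "norm t"] by simp
    moreover have "0 \<le> norm s * norm t" by simp
    ultimately show ?thesis using Cauchy_Schwarz_ineq2[of s t] by linarith
  qed
  then show "AE z in lebesgue_on \<Omega>. norm (f z \<bullet> g z) \<le> norm ((norm (f z))\<^sup>2 + (norm (g z))\<^sup>2)"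
    by simp
qed

lemma L2_lincomb:
  assumes f: "f \<in> L2 \<Omega>" and g: "g \<in> L2 \<Omega>"
  shows "(\<lambda>z. a *\<^sub>R f z + b *\<^sub>R g z) \<in> L2 \<Omega>"
proof -
  have eq: "(norm (a *\<^sub>R f z + b *\<^sub>R g z))\<^sup>2 =
      a\<^sup>2 * (norm (f z))\<^sup>2 + 2 * a * b * (f z \<bullet> g z) + b\<^sup>2 * (norm (g z))\<^sup>2" for z
    unfolding power2_norm_eq_inner
    by (simp add: inner_simps inner_commute[of "g z" "f z"] power2_eq_square algebra_simps)
  have [measurable]: "f \<in> borel_measurable (lebesgue_on \<Omega>)" "g \<in> borel_measurable (lebesgue_on \<Omega>)"
    using f g by (simp_all add: L2_def)
  have "(\<lambda>z. a *\<^sub>R f z + b *\<^sub>R g z) \<in> borel_measurable (lebesgue_on \<Omega>)" by measurable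
  then show ?thesis
    using f g L2_integrable_inner[OF f g] unfolding L2_def by (simp add: eq)
qed

lemma L2_zero: "(\<lambda>z. 0) \<in> L2 \<Omega>"
  by (simp add: L2_def)

lemma L2_bounded:
  assumes "g \<in> borel_measurable (lebesgue_on \<Omega>)" "\<Omega> \<in> lmeasurable" "\<And>z. z \<in> \<Omega> \<Longrightarrow> norm (g z) \<le> M"
  shows "g \<in> L2 \<Omega>"
proof -
  have "integrable (lebesgue_on \<Omega>) (\<lambda>z. (norm (g z))\<^sup>2)"
  proof (rule finite_measure.integrable_const_bound)
    show "finite_measure (lebesgue_on \<Omega>)" by (rule finite_measure_lebesgue_on[OF assms(2)])
    show "AE z in lebesgue_on \<Omega>. norm ((norm (g z))\<^sup>2) \<le> M\<^sup>2"
      by (rule AE_I2) (auto intro!: power_mono assms(3) simp: space_restrict_space)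
    show "(\<lambda>z. (norm (g z))\<^sup>2) \<in> borel_measurable (lebesgue_on \<Omega>)"
      using assms(1) by measurable
  qed
  then show ?thesis using assms(1) by (simp add: L2_def)
qed

lemma L2_inner_commute: "L2_inner \<Omega> f g = L2_inner \<Omega> g f"
  by (simp add: L2_inner_def inner_commute)

lemma L2_inner_lincomb:
  assumes "h \<in> L2 \<Omega>" "f \<in> L2 \<Omega>" "g \<in> L2 \<Omega>"
  shows "L2_inner \<Omega> h (\<lambda>z. a *\<^sub>R f z + b *\<^sub>R g z) = a * L2_inner \<Omega> h f + b * L2_inner \<Omega> h g"
  using L2_integrable_inner[OF assms(1,2)] L2_integrable_inner[OF assms(1,3)]
  by (simp add: L2_inner_def inner_simps)

lemma L2_inner_lincomb_left:
  assumes "h \<in> L2 \<Omega>" "f \<in> L2 \<Omega>" "g \<in> L2 \<Omega>"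
  shows "L2_inner \<Omega> (\<lambda>z. a *\<^sub>R f z + b *\<^sub>R g z) h = a * L2_inner \<Omega> f h + b * L2_inner \<Omega> g h"
  using L2_inner_lincomb[OF assms] by (simp add: L2_inner_commute)

lemma L2_inner_cong:
  assumes "f \<in> L2 \<Omega>" "g \<in> L2 \<Omega>" "L2_eq \<Omega> f g" "h \<in> L2 \<Omega>"
  shows "L2_inner \<Omega> f h = L2_inner \<Omega> g h"
  unfolding L2_inner_def
proof (rule integral_cong_AE)
  show "AE z in lebesgue_on \<Omega>. f z \<bullet> h z = g z \<bullet> h z"
    using assms(3) unfolding L2_eq_def by eventually_elim simp
qed (use L2_integrable_inner assms borel_measurable_integrable in blast)+

lemma L2_inner_null: "L2_eq \<Omega> g (\<lambda>_. 0) \<Longrightarrow> L2_inner \<Omega> f g = 0"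
  unfolding L2_inner_def L2_eq_def by (rule integral_eq_zero_AE) (auto elim: eventually_mono)

lemma L2_inner_self_nonneg: "0 \<le> L2_inner \<Omega> f f"
  by (simp add: L2_inner_def)

lemma L2_norm_power2: "(L2_norm \<Omega> f)\<^sup>2 = L2_inner \<Omega> f f"
  by (simp add: L2_norm_def L2_inner_self_nonneg)

lemma L2_norm_nonneg: "0 \<le> L2_norm \<Omega> f"
  by (simp add: L2_norm_def L2_inner_self_nonneg)

lemma L2_inner_self_eq_0:
  assumes "f \<in> L2 \<Omega>" shows "L2_inner \<Omega> f f = 0 \<longleftrightarrow> L2_eq \<Omega> f (\<lambda>_. 0)"
  using integral_nonneg_eq_0_iff_AE[OF L2_integrable_inner[OF assms assms]]
  by (simp add: L2_inner_def L2_eq_def)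

section \<open>Rows and columns of a conforming grid\<close>

text \<open>The lower left and the upper right corner of a rectangle.\<close>

abbreviation lo :: "(real^2) set \<Rightarrow> real^2" where "lo \<equiv> interval_lowerbound"
abbreviation hi :: "(real^2) set \<Rightarrow> real^2" where "hi \<equiv> interval_upperbound"

lemma rectangle_bounds:
  assumes "is_rectangle K"
  shows "K = cbox (lo K) (hi K)" "lo K $ i < hi K $ i" "interior K = box (lo K) (hi K)"
proof -
  obtain a b where ab: "a$1 < b$1" "a$2 < b$2" and K: "K = cbox a b"
    using assms by (auto simp: is_rectangle_def)
  then have "\<forall>k. a $ k < b $ k" by (simp add: forall_2)
  then have le: "a $ k < b $ k" for k by blast
  have ne: "cbox a b \<noteq> {}" using le by (simp add: interval_ne_empty_cart less_imp_le)
  have "a \<bullet> k \<le> b \<bullet> k" if "k \<in> Basis" for k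
    using that le by (auto simp: Basis_vec_def inner_axis less_imp_le)
  then have "lo K = a" "hi K = b" by (simp_all add: K)
  then show "K = cbox (lo K) (hi K)" "lo K $ i < hi K $ i" "interior K = box (lo K) (hi K)"
    using K le by auto
qed

text \<open>One fixed grid. Directions are indexed by the type \<open>2\<close>, so that rows (direction 1) and columns
  (direction 2) are treated at once; a condition on all \<open>j \<noteq> i\<close> concerns the single other direction.\<close>

locale grid =
  fixes \<Omega> :: "(real^2) set" and \<T> :: "(real^2) set set"
  assumes rectangle: "is_rectangle \<Omega>" and rectangular_grid: "rectangular_grid \<Omega> \<T>"
begin

lemma finite_grid: "finite \<T>" and Union_grid: "\<Union>\<T> = \<Omega>"
  and grid_rectangle: "K \<in> \<T> \<Longrightarrow> is_rectangle K"
  and disjoint_interiors: "K \<in> \<T> \<Longrightarrow> L \<in> \<T> \<Longrightarrow> K \<noteq> L \<Longrightarrow> interior K \<inter> interior L = {}"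
  using rectangular_grid unfolding rectangular_grid_def division_of_def by auto

lemma Int_face_of: "K \<in> \<T> \<Longrightarrow> L \<in> \<T> \<Longrightarrow> (K \<inter> L) face_of K"
  using rectangular_grid unfolding rectangular_grid_def by auto

lemma grid_bounds:
  assumes "K \<in> \<T>"
  shows "K = cbox (lo K) (hi K)" "lo K $ i < hi K $ i" "interior K = box (lo K) (hi K)"
  using rectangle_bounds[OF grid_rectangle[OF assms]] by auto

lemma mem_grid: "K \<in> \<T> \<Longrightarrow> z \<in> K \<longleftrightarrow> (\<forall>k. lo K $ k \<le> z $ k \<and> z $ k \<le> hi K $ k)"
  and mem_interior_grid: "K \<in> \<T> \<Longrightarrow> z \<in> interior K \<longleftrightarrow> (\<forall>k. lo K $ k < z $ k \<and> z $ k < hi K $ k)"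
  using grid_bounds(1,3)[of K] mem_box_cart by blast+

lemma mem_domain: "z \<in> \<Omega> \<longleftrightarrow> (\<forall>k. lo \<Omega> $ k \<le> z $ k \<and> z $ k \<le> hi \<Omega> $ k)"
  using rectangle_bounds(1)[OF rectangle] mem_box_cart by blast

lemma grid_subset: "K \<in> \<T> \<Longrightarrow> K \<subseteq> \<Omega>"
  using Union_grid by auto

lemma grid_bounds_le:
  assumes "K \<in> \<T>" shows "lo \<Omega> $ i \<le> lo K $ i" "hi K $ i \<le> hi \<Omega> $ i"
proof -
  have "lo K \<in> K" "hi K \<in> K"
    using mem_grid[OF assms] grid_bounds(2)[OF assms] by (auto simp: less_imp_le)
  then show "lo \<Omega> $ i \<le> lo K $ i" "hi K $ i \<le> hi \<Omega> $ i"
    using grid_subset[OF assms] mem_domain by blast+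
qed

text \<open>Conformity enters here: the common point \<open>z\<close> lies in the relative interior of a segment of \<open>K\<close>
  that runs in direction \<open>j\<close> from side to side, so the face \<open>K \<inter> L\<close> contains the whole segment.\<close>

lemma same_range_if_meet:
  assumes KL: "K \<in> \<T>" "L \<in> \<T>" and z: "z \<in> K" "z \<in> L"
    and K: "lo K $ j < z $ j" "z $ j < hi K $ j" and L: "lo L $ j < z $ j" "z $ j < hi L $ j"
  shows "lo K $ j = lo L $ j \<and> hi K $ j = hi L $ j"
proof -
  have sub: "lo N $ j \<le> lo M $ j \<and> hi M $ j \<le> hi N $ j"
    if M: "M \<in> \<T>" "z \<in> M" "lo M $ j < z $ j" "z $ j < hi M $ j" and N: "N \<in> \<T>" "z \<in> N" for M N
  proof -
    define p where "p = (\<chi> k. if k = j then lo M $ j else z $ k)"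
    define q where "q = (\<chi> k. if k = j then hi M $ j else z $ k)"
    define u where "u = (z $ j - lo M $ j) / (hi M $ j - lo M $ j)"
    have pq: "p \<in> M" "q \<in> M"
      using M mem_grid[OF M(1)] grid_bounds(2)[OF M(1), of j] by (auto simp: p_def q_def)
    have u: "0 < u" "u < 1" "u * (hi M $ j - lo M $ j) = z $ j - lo M $ j"
      using M by (auto simp: u_def)
    have "z = (1 - u) *\<^sub>R p + u *\<^sub>R q"
      using u(3) by (auto simp: vec_eq_iff p_def q_def algebra_simps)
    moreover have "p \<noteq> q" using M by (auto simp: p_def q_def vec_eq_iff)
    ultimately have "z \<in> open_segment p q"
      using u by (auto simp: in_segment)
    then have "p \<in> N" "q \<in> N"
      using face_ofD[OF Int_face_of[OF M(1) N(1)] _ pq, of z] M(2) N(2) by auto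
    then have "lo N $ j \<le> p $ j" "q $ j \<le> hi N $ j"
      using mem_grid[OF N(1)] by blast+
    then show ?thesis by (simp add: p_def q_def)
  qed
  show ?thesis using sub[of K L] sub[of L K] assms by auto
qed

text \<open>A conforming partition of a rectangle is a tensor product grid: elements whose sides in direction
  \<open>j\<close> overlap have the same side in that direction. On a line of \<open>\<Omega>\<close> that meets both elements and contains
  no edge, the elements with the \<open>j\<close>-range of \<open>K\<close> and the remaining ones cover disjoint closed sets,
  and the line is connected.\<close>

lemma overlap_imp_same_range:
  assumes K: "K \<in> \<T>" and L: "L \<in> \<T>"
    and overlap: "max (lo K $ j) (lo L $ j) < min (hi K $ j) (hi L $ j)"
  shows "lo K $ j = lo L $ j \<and> hi K $ j = hi L $ j"
proof (rule ccontr)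
  assume neq: "\<not> ?thesis"
  let ?E = "(\<lambda>M. lo M $ j) ` \<T> \<union> (\<lambda>M. hi M $ j) ` \<T>"
  \<comment> \<open>A level in the overlap that avoids the finitely many grid lines.\<close>
  have "infinite ({max (lo K $ j) (lo L $ j)<..<min (hi K $ j) (hi L $ j)} - ?E)"
    using finite_grid infinite_Ioo[OF overlap] by (intro Diff_infinite_finite) auto
  then obtain y where y: "max (lo K $ j) (lo L $ j) < y" "y < min (hi K $ j) (hi L $ j)" "y \<notin> ?E"
    by (metis (no_types, lifting) DiffE finite.emptyI greaterThanLessThan_iff ex_in_conv)
  define X where "X = \<Omega> \<inter> {z. z $ j = y}"
  define S where "S = {M \<in> \<T>. lo M $ j = lo K $ j \<and> hi M $ j = hi K $ j}"
  have strict: "lo M $ j < z $ j \<and> z $ j < hi M $ j" if "M \<in> \<T>" "z \<in> M" "z $ j = y" for M z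
  proof -
    have "lo M $ j \<noteq> y" "hi M $ j \<noteq> y" using y(3) that(1) by auto
    moreover have "lo M $ j \<le> z $ j \<and> z $ j \<le> hi M $ j" using mem_grid that(1,2) by blast
    ultimately show ?thesis using that(3) by auto
  qed
  have meets: "X \<inter> M \<noteq> {}" if "M \<in> \<T>" "lo M $ j < y" "y < hi M $ j" for M
  proof -
    have "(\<chi> k. if k = j then y else lo M $ k) \<in> M"
      using that mem_grid[OF that(1)] grid_bounds(2)[OF that(1)] by (auto simp: less_imp_le)
    then show ?thesis using grid_subset[OF that(1)] by (auto simp: X_def)
  qed
  have "convex X"
  proof -
    have "convex {z :: real^2. axis j 1 \<bullet> z = y}" by (rule convex_hyperplane)
    then have "convex {z :: real^2. z $ j = y}" by (simp add: inner_axis' )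
    moreover have "convex \<Omega>" using rectangle by (auto simp: is_rectangle_def)
    ultimately show ?thesis unfolding X_def by (rule convex_Int[rotated])
  qed
  then have "connected X" by (rule convex_connected)
  moreover have "closed (\<Union>S)" "closed (\<Union>(\<T> - S))"
  proof -
    have "closed M" if "M \<in> \<T>" for M using grid_bounds(1)[OF that] closed_cbox by metis
    then show "closed (\<Union>S)" "closed (\<Union>(\<T> - S))"
      using finite_grid by (auto intro!: closed_Union simp: S_def)
  qed
  moreover have "X \<subseteq> \<Union>S \<union> \<Union>(\<T> - S)" using Union_grid by (auto simp: X_def)
  moreover have "\<Union>S \<inter> \<Union>(\<T> - S) \<inter> X = {}"
  proof -
    have False if "M \<in> S" "N \<in> \<T> - S" "z \<in> M" "z \<in> N" "z \<in> X" for M N z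
    proof -
      have "M \<in> \<T>" "N \<in> \<T>" "z $ j = y" using that by (auto simp: S_def X_def)
      with strict that(3,4) have "lo M $ j = lo N $ j \<and> hi M $ j = hi N $ j"
        by (intro same_range_if_meet[of M N z]) auto
      then show False using that(1,2) by (auto simp: S_def)
    qed
    then show ?thesis by blast
  qed
  moreover have "\<Union>S \<inter> X \<noteq> {}"
    using meets[OF K] K y by (auto simp: S_def)
  moreover have "\<Union>(\<T> - S) \<inter> X \<noteq> {}"
  proof -
    have "L \<in> \<T> - S" using L neq by (auto simp: S_def)
    then show ?thesis using meets[OF L] y by auto
  qed
  ultimately show False unfolding connected_closed by blast
qed

text \<open>The elements that form a row in direction \<open>i\<close> with \<open>K\<close>, and those whose open strip in direction
  \<open>i\<close> contains the point \<open>z\<close>. The latter set is empty if \<open>z\<close> lies on a grid line parallel to direction \<open>i\<close>.\<close>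

definition grid_row :: "2 \<Rightarrow> (real^2) set \<Rightarrow> (real^2) set set" where
  "grid_row i K = {L \<in> \<T>. \<forall>j. j \<noteq> i \<longrightarrow> lo L $ j = lo K $ j \<and> hi L $ j = hi K $ j}"

definition row_at :: "2 \<Rightarrow> real^2 \<Rightarrow> (real^2) set set" where
  "row_at i z = {L \<in> \<T>. \<forall>j. j \<noteq> i \<longrightarrow> lo L $ j < z $ j \<and> z $ j < hi L $ j}"

lemma row_at_subset_row:
  assumes "K \<in> row_at i z" shows "row_at i z \<subseteq> grid_row i K"
proof
  fix L assume L: "L \<in> row_at i z"
  have "lo L $ j = lo K $ j \<and> hi L $ j = hi K $ j" if "j \<noteq> i" for j
  proof (rule overlap_imp_same_range)
    have "lo K $ j < z $ j" "z $ j < hi K $ j" "lo L $ j < z $ j" "z $ j < hi L $ j"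
      using assms L that by (auto simp: row_at_def)
    then show "max (lo L $ j) (lo K $ j) < min (hi L $ j) (hi K $ j)" by linarith
  qed (use assms L in \<open>auto simp: row_at_def\<close>)
  then show "L \<in> grid_row i K" using L by (auto simp: grid_row_def row_at_def)
qed

lemma row_at_interior:
  assumes "K \<in> \<T>" "z \<in> interior K" shows "row_at i z = grid_row i K"
proof
  have K: "K \<in> row_at i z" using assms mem_interior_grid by (auto simp: row_at_def)
  then show "row_at i z \<subseteq> grid_row i K" by (rule row_at_subset_row)
  show "grid_row i K \<subseteq> row_at i z" using K by (auto simp: row_at_def grid_row_def)
qed

lemma row_separated:
  assumes K: "K \<in> \<T>" and L: "L \<in> grid_row i K" "L \<noteq> K"
  shows "hi L $ i \<le> lo K $ i \<or> hi K $ i \<le> lo L $ i"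
proof -
  have LT: "L \<in> \<T>" using L by (simp add: grid_row_def)
  have "box (lo K) (hi K) \<inter> box (lo L) (hi L) = {}"
    using disjoint_interiors[OF K LT] L(2) grid_bounds(3)[OF K] grid_bounds(3)[OF LT] by auto
  then obtain k where k: "hi K $ k \<le> lo K $ k \<or> hi L $ k \<le> lo L $ k \<or> hi K $ k \<le> lo L $ k \<or> hi L $ k \<le> lo K $ k"
    unfolding disjoint_interval_cart by blast
  have "lo K $ k < hi K $ k" "lo L $ k < hi L $ k"
    using grid_bounds(2) K LT by auto
  with k L(1) show ?thesis by (cases "k = i") (auto simp: grid_row_def)
qed

lemma row_at_separated:
  assumes "K \<in> row_at i z" "L \<in> row_at i z" "L \<noteq> K"
  shows "hi L $ i \<le> lo K $ i \<or> hi K $ i \<le> lo L $ i"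
  using row_separated[of K L i] row_at_subset_row[OF assms(1)] assms by (auto simp: row_at_def)

lemma row_eq_if_shared_points:
  assumes K: "K \<in> \<T>" and L: "L \<in> \<T>" and pq: "p \<in> K \<inter> L" "q \<in> K \<inter> L"
    and neq: "\<And>j. j \<noteq> i \<Longrightarrow> p $ j \<noteq> q $ j"
  shows "grid_row i K = grid_row i L"
proof -
  have "lo K $ j = lo L $ j \<and> hi K $ j = hi L $ j" if "j \<noteq> i" for j
  proof (rule overlap_imp_same_range[OF K L])
    have "lo M $ j \<le> min (p $ j) (q $ j) \<and> max (p $ j) (q $ j) \<le> hi M $ j" if "M \<in> {K, L}" for M
      using pq mem_grid[OF K] mem_grid[OF L] that by auto
    then have "lo K $ j \<le> min (p $ j) (q $ j)" "max (p $ j) (q $ j) \<le> hi K $ j"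
      "lo L $ j \<le> min (p $ j) (q $ j)" "max (p $ j) (q $ j) \<le> hi L $ j" by auto
    then show "max (lo K $ j) (lo L $ j) < min (hi K $ j) (hi L $ j)" using neq[OF that] by linarith
  qed
  then show ?thesis by (auto simp: grid_row_def)
qed

lemma sum_row_widths:
  "(\<Sum>L\<in>row_at i z. hi L $ i - lo L $ i) \<le> hi \<Omega> $ i - lo \<Omega> $ i"
proof -
  let ?R = "row_at i z"
  have fin: "finite ?R" using finite_grid by (simp add: row_at_def)
  have T: "L \<in> \<T>" if "L \<in> ?R" for L using that by (simp add: row_at_def)
  have "(\<Sum>L\<in>?R. hi L $ i - lo L $ i) = (\<Sum>L\<in>?R. measure lborel {lo L $ i<..<hi L $ i})"
    using T grid_bounds(2) by (intro sum.cong) (auto simp: less_imp_le)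
  also have "\<dots> = measure lborel (\<Union>L\<in>?R. {lo L $ i<..<hi L $ i})"
  proof (rule measure_UNION'[symmetric])
    show "pairwise (\<lambda>K L. disjnt {lo K $ i<..<hi K $ i} {lo L $ i<..<hi L $ i}) ?R"
      unfolding pairwise_def disjnt_def
    proof (intro ballI impI)
      fix K L assume "K \<in> ?R" "L \<in> ?R" "K \<noteq> L"
      from row_at_separated[OF this(1,2)] this(3)
      show "{lo K $ i<..<hi K $ i} \<inter> {lo L $ i<..<hi L $ i} = {}" by auto
    qed
  qed (use fin T grid_bounds(2) in \<open>auto simp: fmeasurable_def less_imp_le\<close>)
  also have "\<dots> \<le> measure lborel {lo \<Omega> $ i..hi \<Omega> $ i}"
  proof (rule measure_mono_fmeasurable)
    show "(\<Union>L\<in>?R. {lo L $ i<..<hi L $ i}) \<subseteq> {lo \<Omega> $ i..hi \<Omega> $ i}"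
    proof (rule UN_least)
      fix L assume "L \<in> ?R"
      from grid_bounds_le[OF T[OF this], of i]
      show "{lo L $ i<..<hi L $ i} \<subseteq> {lo \<Omega> $ i..hi \<Omega> $ i}" by auto
    qed
    show "(\<Union>L\<in>?R. {lo L $ i<..<hi L $ i}) \<in> sets lborel"
      using fin by (intro sets.finite_UN) auto
  qed (use rectangle_bounds(2)[OF rectangle, of i] in \<open>simp add: fmeasurable_def\<close>)
  also have "\<dots> = hi \<Omega> $ i - lo \<Omega> $ i"
    using rectangle_bounds(2)[OF rectangle, of i] by simp
  finally show ?thesis .
qed

end

lemma borel_measurable_lebesgue_onI:
  "f \<in> borel_measurable borel \<Longrightarrow> f \<in> borel_measurable (lebesgue_on S)"
  by (intro measurable_restrict_space1 measurable_completion) simp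

section \<open>Local stress fields\<close>

lemma transpose_eq_iff: "transpose (M :: real^2^2) = M \<longleftrightarrow> M$2$1 = M$1$2"
  unfolding vec_eq_iff forall_2 transpose_def by auto

lemma Sigma_loc_iff:
  "p \<in> Sigma_loc \<longleftrightarrow> (\<exists>M0 M1 M2. (\<forall>z. p z = M0 + z$1 *\<^sub>R M1 + z$2 *\<^sub>R M2) \<and>
     transpose M0 = M0 \<and> transpose M1 = M1 \<and> transpose M2 = M2 \<and> M2$1$1 = 0 \<and> M1$2$2 = 0)"
    (is "_ \<longleftrightarrow> ?R")
proof
  assume "p \<in> Sigma_loc"
  then obtain a0 a1 b0 b1 c0 c1 c2 where "\<forall>z. p z = vector [vector [a0 + a1 * z$1, c0 + c1 * z$1 + c2 * z$2],
                   vector [c0 + c1 * z$1 + c2 * z$2, b0 + b1 * z$2]]" unfolding Sigma_loc_def by blast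
  then show ?R
    unfolding transpose_eq_iff
    by (intro exI[of _ "vector [vector [a0, c0], vector [c0, b0]]"]
        exI[of _ "vector [vector [a1, c1], vector [c1, 0]]"]
        exI[of _ "vector [vector [0, c2], vector [c2, b1]]"])
      (simp add: vec_eq_iff forall_2)
next
  assume ?R
  then obtain M0 M1 M2 where M: "\<And>z. p z = M0 + z$1 *\<^sub>R M1 + z$2 *\<^sub>R M2"
    and t: "transpose M0 = M0" "transpose M1 = M1" "transpose M2 = M2" and 0: "M2$1$1 = 0" "M1$2$2 = 0"
    by blast
  have "M0$2$1 = M0$1$2" "M1$2$1 = M1$1$2" "M2$2$1 = M2$1$2"
    using t by (simp_all add: transpose_eq_iff)
  then have "p z = vector [vector [M0$1$1 + M1$1$1 * z$1, M0$1$2 + M1$1$2 * z$1 + M2$1$2 * z$2],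
                   vector [M0$1$2 + M1$1$2 * z$1 + M2$1$2 * z$2, M0$2$2 + M2$2$2 * z$2]]" for z
    by (simp add: vec_eq_iff forall_2 M 0)
  then show "p \<in> Sigma_loc" unfolding Sigma_loc_def by blast
qed

lemma Sigma_loc_lincomb:
  assumes "p \<in> Sigma_loc" "q \<in> Sigma_loc" shows "(\<lambda>z. a *\<^sub>R p z + b *\<^sub>R q z) \<in> Sigma_loc"
proof -
  obtain M0 M1 M2 N0 N1 N2 where
    "\<forall>z. p z = M0 + z$1 *\<^sub>R M1 + z$2 *\<^sub>R M2" "\<forall>z. q z = N0 + z$1 *\<^sub>R N1 + z$2 *\<^sub>R N2"
    "transpose M0 = M0" "transpose M1 = M1" "transpose M2 = M2" "M2$1$1 = 0" "M1$2$2 = 0"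
    "transpose N0 = N0" "transpose N1 = N1" "transpose N2 = N2" "N2$1$1 = 0" "N1$2$2 = 0"
    using assms unfolding Sigma_loc_iff by metis
  then show ?thesis unfolding Sigma_loc_iff
    by (intro exI[of _ "a *\<^sub>R M0 + b *\<^sub>R N0"] exI[of _ "a *\<^sub>R M1 + b *\<^sub>R N1"] exI[of _ "a *\<^sub>R M2 + b *\<^sub>R N2"])
      (simp add: transpose_eq_iff algebra_simps)
qed

lemma Sigma_loc_continuous:
  assumes "p \<in> Sigma_loc" shows "continuous_on S p"
proof -
  obtain M0 M1 M2 where "p = (\<lambda>z. M0 + z$1 *\<^sub>R M1 + z$2 *\<^sub>R M2)"
    using assms unfolding Sigma_loc_iff by blast
  then show ?thesis by (simp add: continuous_intros)
qed

lemma divergence_affine: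
  assumes "open U" "z \<in> U" and \<tau>: "\<And>w. w \<in> U \<Longrightarrow> \<tau> w = M0 + w$1 *\<^sub>R M1 + w$2 *\<^sub>R M2"
  shows "divergence \<tau> z = (\<chi> i. M1$i$1 + M2$i$2)"
proof -
  have "frechet_derivative (\<lambda>w. \<tau> w $ i $ j) (at z) = (\<lambda>h. h$1 * M1$i$j + h$2 * M2$i$j)" for i j
  proof (rule frechet_derivative_at[symmetric])
    have "((\<lambda>w. M0$i$j + w$1 * M1$i$j + w$2 * M2$i$j) has_derivative
        (\<lambda>h. h$1 * M1$i$j + h$2 * M2$i$j)) (at z)"
      by (auto intro!: derivative_eq_intros bounded_linear.has_derivative[OF bounded_linear_vec_nth])
    then show "((\<lambda>w. \<tau> w $ i $ j) has_derivative (\<lambda>h. h$1 * M1$i$j + h$2 * M2$i$j)) (at z)"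
      by (rule has_derivative_transform_within_open[OF _ assms(1,2)]) (simp add: \<tau>)
  qed
  then show ?thesis by (simp add: divergence_def vec_eq_iff UNIV_2 axis_def)
qed

section \<open>Integration along rows\<close>

context grid
begin

text \<open>For a function equal to \<open>c L\<close> on each element \<open>L\<close>, this is its integral along direction \<open>i\<close> from
  the boundary of \<open>\<Omega>\<close> to \<open>z\<close>: the difference of minima is the length of the part of the side of \<open>L\<close> that
  lies before \<open>z\<close>.\<close>

definition primitive :: "((real^2) set \<Rightarrow> real) \<Rightarrow> 2 \<Rightarrow> real^2 \<Rightarrow> real" where
  "primitive c i z = (\<Sum>L\<in>row_at i z. c L * (min (z$i) (hi L $ i) - min (z$i) (lo L $ i)))"

text \<open>The same integral as a function of one variable, along the row of \<open>K\<close>.\<close>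

definition row_primitive :: "((real^2) set \<Rightarrow> real) \<Rightarrow> 2 \<Rightarrow> (real^2) set \<Rightarrow> real \<Rightarrow> real" where
  "row_primitive c i K t = (\<Sum>L\<in>grid_row i K. c L * (min t (hi L $ i) - min t (lo L $ i)))"

lemma primitive_interior:
  "K \<in> \<T> \<Longrightarrow> z \<in> interior K \<Longrightarrow> primitive c i z = row_primitive c i K (z$i)"
  by (simp add: primitive_def row_primitive_def row_at_interior)

lemma row_primitive_affine:
  assumes K: "K \<in> \<T>" and t: "lo K $ i \<le> t" "t \<le> hi K $ i"
  shows "row_primitive c i K t = row_primitive c i K (lo K $ i) + c K * (t - lo K $ i)"
proof -
  have fin: "finite (grid_row i K)" and KK: "K \<in> grid_row i K" using finite_grid K by (auto simp: grid_row_def)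
  have "c L * (min t (hi L $ i) - min t (lo L $ i)) =
      c L * (min (lo K $ i) (hi L $ i) - min (lo K $ i) (lo L $ i)) + (if L = K then c K * (t - lo K $ i) else 0)"
    if L: "L \<in> grid_row i K" for L
  proof (cases "L = K")
    case True
    then show ?thesis using t grid_bounds(2)[OF K, of i] by (simp add: min_def)
  next
    case False
    have "lo L $ i < hi L $ i" using L grid_bounds(2) by (simp add: grid_row_def)
    then show ?thesis using row_separated[OF K L False] t False by (auto simp: min_def)
  qed
  then have "row_primitive c i K t = (\<Sum>L\<in>grid_row i K. c L * (min (lo K $ i) (hi L $ i) - min (lo K $ i) (lo L $ i))
      + (if L = K then c K * (t - lo K $ i) else 0))"
    unfolding row_primitive_def by (rule sum.cong[OF refl])
  then show ?thesis using fin KK by (simp add: sum.distrib row_primitive_def)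
qed

lemma primitive_lincomb:
  "primitive (\<lambda>K. a * c K + b * d K) i z = a * primitive c i z + b * primitive d i z"
  by (simp add: primitive_def sum_distrib_left sum.distrib[symmetric] algebra_simps)

text \<open>The open infinite strip in direction \<open>i\<close> spanned by \<open>L\<close>.\<close>

definition strip :: "2 \<Rightarrow> (real^2) set \<Rightarrow> (real^2) set" where
  "strip i L = {z. \<forall>j. j \<noteq> i \<longrightarrow> lo L $ j < z $ j \<and> z $ j < hi L $ j}"

lemma sum_row_at: "(\<Sum>L\<in>row_at i z. g L) = (\<Sum>L\<in>\<T>. indicator (strip i L) z * (g L :: real))"
proof -
  have "row_at i z = {L \<in> \<T>. z \<in> strip i L}" by (auto simp: row_at_def strip_def)
  then have "(\<Sum>L\<in>row_at i z. g L) = (\<Sum>L\<in>\<T>. if z \<in> strip i L then g L else 0)"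
    by (simp only: sum.inter_filter[OF finite_grid])
  also have "\<dots> = (\<Sum>L\<in>\<T>. indicator (strip i L) z * g L)"
    by (rule sum.cong) (auto simp: indicator_def)
  finally show ?thesis .
qed

lemma strip_borel [measurable]: "strip i L \<in> sets borel"
proof -
  have "open (strip i L)"
  proof -
    have "strip i L = (\<Inter>j\<in>-{i}. {z. lo L $ j < z $ j} \<inter> {z. z $ j < hi L $ j})"
      by (auto simp: strip_def)
    then show ?thesis
      by (auto intro!: open_INT open_Int open_Collect_less continuous_intros)
  qed
  then show ?thesis by simp
qed

lemma primitive_borel [measurable]: "primitive c i \<in> borel_measurable borel"
proof -
  have [measurable]: "(\<lambda>z::real^2. z $ i) \<in> borel_measurable borel"
    by (intro borel_measurable_continuous_onI continuous_intros)
  show ?thesis unfolding primitive_def sum_row_at by measurable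
qed

text \<open>Cauchy-Schwarz along the row through \<open>z\<close>, whose elements have total width at most that of \<open>\<Omega>\<close>.\<close>

lemma primitive_square_le:
  "(primitive c i z)\<^sup>2 \<le>
     (hi \<Omega> $ i - lo \<Omega> $ i) * (\<Sum>L\<in>row_at i z. (c L)\<^sup>2 * (hi L $ i - lo L $ i))"
proof -
  let ?m = "\<lambda>L. min (z$i) (hi L $ i) - min (z$i) (lo L $ i)"
  have m: "0 \<le> ?m L" "?m L \<le> hi L $ i - lo L $ i" if "L \<in> row_at i z" for L
    using that grid_bounds(2)[of L i] by (auto simp: row_at_def min_def)
  have "(primitive c i z)\<^sup>2 = (\<Sum>L\<in>row_at i z. (c L * sqrt (?m L)) * sqrt (?m L))\<^sup>2"
    unfolding primitive_def using m(1)
    by (intro arg_cong[where f = "\<lambda>x. x\<^sup>2"] sum.cong) (simp_all add: mult.assoc)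
  also have "\<dots> \<le> (\<Sum>L\<in>row_at i z. (c L * sqrt (?m L))\<^sup>2) * (\<Sum>L\<in>row_at i z. (sqrt (?m L))\<^sup>2)"
    by (rule Cauchy_Schwarz_ineq_sum)
  also have "\<dots> = (\<Sum>L\<in>row_at i z. (c L)\<^sup>2 * ?m L) * (\<Sum>L\<in>row_at i z. ?m L)"
    using m(1) by (simp add: power_mult_distrib)
  also have "\<dots> \<le> (\<Sum>L\<in>row_at i z. (c L)\<^sup>2 * (hi L $ i - lo L $ i)) * (hi \<Omega> $ i - lo \<Omega> $ i)"
  proof (rule mult_mono)
    show "(\<Sum>L\<in>row_at i z. ?m L) \<le> hi \<Omega> $ i - lo \<Omega> $ i"
      using sum_mono[of "row_at i z" ?m "\<lambda>L. hi L $ i - lo L $ i"] m(2) sum_row_widths[of i z] by force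
    show "(\<Sum>L\<in>row_at i z. (c L)\<^sup>2 * ?m L) \<le> (\<Sum>L\<in>row_at i z. (c L)\<^sup>2 * (hi L $ i - lo L $ i))"
      using m(2) by (intro sum_mono mult_left_mono) auto
    show "0 \<le> (\<Sum>L\<in>row_at i z. (c L)\<^sup>2 * (hi L $ i - lo L $ i))"
      using grid_bounds(2) by (intro sum_nonneg mult_nonneg_nonneg) (auto simp: row_at_def less_imp_le)
    show "0 \<le> (\<Sum>L\<in>row_at i z. ?m L)" using m(1) by (rule sum_nonneg)
  qed
  finally show ?thesis by (simp add: mult.commute)
qed

lemma domain_lmeasurable: "\<Omega> \<in> lmeasurable"
  using rectangle_bounds(1)[OF rectangle] lmeasurable_cbox by metis

text \<open>The Poincare-type estimate behind the uniform stability constant. The pointwise bound contributes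
  one factor equal to the width of \<open>\<Omega>\<close>; the other one comes from integrating the bound, which is constant
  along direction \<open>i\<close>, across \<open>\<Omega>\<close>. No shape regularity of the grid is used.\<close>

lemma primitive_square_integral:
  "integrable (lebesgue_on \<Omega>) (\<lambda>z. (primitive c i z)\<^sup>2)"
  "(LINT z|lebesgue_on \<Omega>. (primitive c i z)\<^sup>2) \<le>
     (hi \<Omega> $ i - lo \<Omega> $ i)\<^sup>2 * (\<Sum>L\<in>\<T>. (c L)\<^sup>2 * measure lebesgue L)"
proof -
  let ?W = "hi \<Omega> $ i - lo \<Omega> $ i" and ?w = "\<lambda>L. hi L $ i - lo L $ i"
  let ?G = "\<lambda>z. ?W * (\<Sum>L\<in>\<T>. indicator (strip i L) z * ((c L)\<^sup>2 * ?w L))"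
  interpret finite_measure "lebesgue_on \<Omega>"
    by (rule finite_measure_lebesgue_on[OF domain_lmeasurable])
  have W: "0 < ?W" using rectangle_bounds(2)[OF rectangle] by simp
  have le: "(primitive c i z)\<^sup>2 \<le> ?G z" for z
    using primitive_square_le[of c i z] unfolding sum_row_at .
  have strip: "strip i L \<inter> \<Omega> \<in> sets lebesgue" for L
    using strip_borel domain_lmeasurable by auto
  have ind: "integrable (lebesgue_on \<Omega>) (indicator (strip i L) :: _ \<Rightarrow> real)" for L
    by (rule integrable_const_bound[where B = 1]) (auto intro: borel_measurable_lebesgue_onI)
  then have intG: "integrable (lebesgue_on \<Omega>) ?G" by simp
  show int: "integrable (lebesgue_on \<Omega>) (\<lambda>z. (primitive c i z)\<^sup>2)"
  proof (rule Bochner_Integration.integrable_bound[OF intG])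
    show "(\<lambda>z. (primitive c i z)\<^sup>2) \<in> borel_measurable (lebesgue_on \<Omega>)"
      by (rule borel_measurable_lebesgue_onI) measurable
    show "AE z in lebesgue_on \<Omega>. norm ((primitive c i z)\<^sup>2) \<le> norm (?G z)"
    proof (rule AE_I2)
      fix z show "norm ((primitive c i z)\<^sup>2) \<le> norm (?G z)"
        using le[of z] by simp
    qed
  qed
  have strip_measure: "measure (lebesgue_on \<Omega>) (strip i L \<inter> \<Omega>) * ?w L \<le> ?W * measure lebesgue L"
    if L: "L \<in> \<T>" for L
  proof -
    define p where "p = (\<chi> k. if k = i then lo \<Omega> $ i else lo L $ k)"
    define q where "q = (\<chi> k. if k = i then hi \<Omega> $ i else hi L $ k)"
    have w: "0 < ?w L" using grid_bounds(2)[OF L] by simp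
    have pq: "p $ k \<le> q $ k" for k
      using W grid_bounds(2)[OF L, of k] by (auto simp: p_def q_def)
    have "measure (lebesgue_on \<Omega>) (strip i L \<inter> \<Omega>) = measure lebesgue (strip i L \<inter> \<Omega>)"
      using domain_lmeasurable by (intro measure_restrict_space) auto
    also have "\<dots> \<le> measure lebesgue (cbox p q)"
    proof (rule measure_mono_fmeasurable[OF _ strip])
      show "strip i L \<inter> \<Omega> \<subseteq> cbox p q"
        using mem_domain by (auto simp: mem_box_cart strip_def p_def q_def less_imp_le)
    qed simp
    also have "\<dots> = (\<Prod>k\<in>UNIV. q $ k - p $ k)"
      using pq by (simp add: content_cbox_cart interval_ne_empty_cart)
    also have "\<dots> = ?W * (\<Prod>k\<in>UNIV - {i}. hi L $ k - lo L $ k)"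
      by (subst prod.remove[of _ i]) (simp_all add: p_def q_def)
    finally have "measure (lebesgue_on \<Omega>) (strip i L \<inter> \<Omega>) * ?w L
        \<le> ?W * (?w L * (\<Prod>k\<in>UNIV - {i}. hi L $ k - lo L $ k))"
      using w by (simp add: mult_right_mono mult.assoc mult.commute[of "?w L"])
    also have "?w L * (\<Prod>k\<in>UNIV - {i}. hi L $ k - lo L $ k) = (\<Prod>k\<in>UNIV. hi L $ k - lo L $ k)"
      by (subst (2) prod.remove[of _ i]) simp_all
    also have "\<dots> = measure lebesgue (cbox (lo L) (hi L))"
      using grid_bounds(2)[OF L] by (simp add: content_cbox_cart interval_ne_empty_cart less_imp_le)
    finally show ?thesis using grid_bounds(1)[OF L] by simp
  qed
  have "(LINT z|lebesgue_on \<Omega>. (primitive c i z)\<^sup>2) \<le> (LINT z|lebesgue_on \<Omega>. ?G z)"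
    using int intG le by (rule integral_mono)
  also have "\<dots> = ?W * (\<Sum>L\<in>\<T>. measure (lebesgue_on \<Omega>) (strip i L \<inter> \<Omega>) * ((c L)\<^sup>2 * ?w L))"
    using ind by simp
  also have "\<dots> \<le> ?W * (\<Sum>L\<in>\<T>. (c L)\<^sup>2 * (?W * measure lebesgue L))"
  proof (intro mult_left_mono sum_mono)
    fix L assume "L \<in> \<T>"
    from mult_left_mono[OF strip_measure[OF this], of "(c L)\<^sup>2"]
    show "measure (lebesgue_on \<Omega>) (strip i L \<inter> \<Omega>) * ((c L)\<^sup>2 * ?w L) \<le> (c L)\<^sup>2 * (?W * measure lebesgue L)"
      by (simp add: mult_ac)
  qed (use W in simp)
  also have "\<dots> = ?W\<^sup>2 * (\<Sum>L\<in>\<T>. (c L)\<^sup>2 * measure lebesgue L)"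
    by (simp add: sum_distrib_left power2_eq_square mult_ac)
  finally show "(LINT z|lebesgue_on \<Omega>. (primitive c i z)\<^sup>2) \<le>
     ?W\<^sup>2 * (\<Sum>L\<in>\<T>. (c L)\<^sup>2 * measure lebesgue L)" .
qed

section \<open>Piecewise functions on the grid\<close>

lemma AE_interior: "AE z in lebesgue_on \<Omega>. \<exists>K\<in>\<T>. z \<in> interior K"
proof -
  have "negligible (\<Union>K\<in>\<T>. K - interior K)"
  proof (rule negligible_Union)
    fix N assume "N \<in> (\<lambda>K. K - interior K) ` \<T>"
    then obtain K where "K \<in> \<T>" "N = K - interior K" by blast
    with grid_bounds(1,3)[OF this(1)] negligible_frontier_interval[of "lo K" "hi K"]
    show "negligible N" by simp
  qed (simp add: finite_grid)
  moreover have "{z. \<not> (z \<in> \<Omega> \<longrightarrow> (\<exists>K\<in>\<T>. z \<in> interior K))} \<subseteq> (\<Union>K\<in>\<T>. K - interior K)"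
    using Union_grid by auto
  ultimately have "AE z in lebesgue. z \<in> \<Omega> \<longrightarrow> (\<exists>K\<in>\<T>. z \<in> interior K)"
    by (intro AE_I'[where N = "\<Union>K\<in>\<T>. K - interior K"]) (auto simp: negligible_iff_null_sets)
  then show ?thesis
    using domain_lmeasurable by (subst AE_restrict_space_iff) auto
qed

lemma L2_eq_if_eq_on_interiors:
  "(\<And>K z. K \<in> \<T> \<Longrightarrow> z \<in> interior K \<Longrightarrow> f z = g z) \<Longrightarrow> L2_eq \<Omega> f g"
  unfolding L2_eq_def using AE_interior by eventually_elim blast

lemma interior_unique: "K \<in> \<T> \<Longrightarrow> L \<in> \<T> \<Longrightarrow> z \<in> interior K \<Longrightarrow> z \<in> interior L \<Longrightarrow> K = L"
  using disjoint_interiors by blast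

lemma zero_on_interior_if_L2_eq:
  assumes "K \<in> \<T>" "L2_eq \<Omega> f (\<lambda>_. 0)" "continuous_on (interior K) f" "z \<in> interior K"
  shows "f z = 0"
proof (rule ccontr)
  assume nz: "f z \<noteq> 0"
  let ?U = "{z \<in> interior K. f z \<in> - {0}}"
  have "open ?U"
  proof -
    have "?U = interior K \<inter> f -` (- {0})" by auto
    then show ?thesis
      using continuous_open_preimage[OF assms(3) open_interior, of "- {0}"] by auto
  qed
  moreover have "z \<in> ?U" using assms(4) nz by simp
  moreover have "negligible ?U"
  proof -
    have "AE z in lebesgue. z \<in> \<Omega> \<longrightarrow> f z = 0"
      using assms(2) domain_lmeasurable unfolding L2_eq_def by (subst (asm) AE_restrict_space_iff) auto
    then have "AE z in lebesgue. z \<notin> ?U"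
      by eventually_elim (use grid_subset[OF assms(1)] interior_subset in auto)
    then have "{z. z \<in> ?U} \<in> null_sets lebesgue"
      using \<open>open ?U\<close> by (subst (asm) AE_iff_null_sets[symmetric]) auto
    then show ?thesis by (simp add: negligible_iff_null_sets)
  qed
  ultimately show False using open_not_negligible by blast
qed

end

section \<open>The discrete spaces\<close>

lemma L2_sym_L2: "\<tau> \<in> L2_sym \<Omega> \<Longrightarrow> \<tau> \<in> L2 \<Omega>"
  by (simp add: L2_sym_def)

lemma L2_sym_lincomb:
  assumes "\<sigma> \<in> L2_sym \<Omega>" "\<tau> \<in> L2_sym \<Omega>" shows "(\<lambda>z. a *\<^sub>R \<sigma> z + b *\<^sub>R \<tau> z) \<in> L2_sym \<Omega>"
proof -
  have "AE z in lebesgue_on \<Omega>. transpose (\<sigma> z) = \<sigma> z" "AE z in lebesgue_on \<Omega>. transpose (\<tau> z) = \<tau> z"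
    using assms by (simp_all add: L2_sym_def)
  then have "AE z in lebesgue_on \<Omega>. transpose (a *\<^sub>R \<sigma> z + b *\<^sub>R \<tau> z) = a *\<^sub>R \<sigma> z + b *\<^sub>R \<tau> z"
    by eventually_elim (simp add: transpose_eq_iff)
  then show ?thesis using assms by (simp add: L2_sym_def L2_lincomb)
qed

lemma continuous_across_lincomb:
  assumes "continuous_across \<T> g e z" "continuous_across \<T> k e z"
  shows "continuous_across \<T> (\<lambda>w. a * g w + b * k w) e z"
proof -
  obtain l m where "\<forall>K\<in>\<T>. e \<subseteq> K \<longrightarrow> (g \<longlongrightarrow> l) (at z within interior K)"
    "\<forall>K\<in>\<T>. e \<subseteq> K \<longrightarrow> (k \<longlongrightarrow> m) (at z within interior K)"
    using assms unfolding continuous_across_def by blast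
  then show ?thesis unfolding continuous_across_def
    by (intro exI[of _ "a * l + b * m"]) (auto intro!: tendsto_intros)
qed

context grid
begin

lemma Sigma_h_L2_sym: "\<tau> \<in> Sigma_h \<Omega> \<T> \<Longrightarrow> \<tau> \<in> L2_sym \<Omega>"
  by (simp add: Sigma_h_def)

lemma Sigma_h_L2: "\<tau> \<in> Sigma_h \<Omega> \<T> \<Longrightarrow> \<tau> \<in> L2 \<Omega>"
  by (simp add: Sigma_h_def L2_sym_def)

lemma Sigma_h_local:
  "\<tau> \<in> Sigma_h \<Omega> \<T> \<Longrightarrow> K \<in> \<T> \<Longrightarrow> \<exists>p\<in>Sigma_loc. \<forall>z\<in>interior K. \<tau> z = p z"
  by (simp add: Sigma_h_def)

lemma V_h_L2: "v \<in> V_h \<Omega> \<T> \<Longrightarrow> v \<in> L2 \<Omega>"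
  by (simp add: V_h_def)

lemma Sigma_h_lincomb:
  assumes "\<sigma> \<in> Sigma_h \<Omega> \<T>" "\<tau> \<in> Sigma_h \<Omega> \<T>"
  shows "(\<lambda>z. a *\<^sub>R \<sigma> z + b *\<^sub>R \<tau> z) \<in> Sigma_h \<Omega> \<T>"
proof -
  have "\<exists>p\<in>Sigma_loc. \<forall>z\<in>interior K. a *\<^sub>R \<sigma> z + b *\<^sub>R \<tau> z = p z" if K: "K \<in> \<T>" for K
  proof -
    obtain p q where "p \<in> Sigma_loc" "q \<in> Sigma_loc" "\<forall>z\<in>interior K. \<sigma> z = p z" "\<forall>z\<in>interior K. \<tau> z = q z"
      using Sigma_h_local[OF assms(1) K] Sigma_h_local[OF assms(2) K] by blast
    then show ?thesis by (intro bexI[OF _ Sigma_loc_lincomb[of p q a b]]) auto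
  qed
  then show ?thesis
    using assms unfolding Sigma_h_def by (simp add: L2_sym_lincomb continuous_across_lincomb)
qed

lemma zero_in_Sigma_h: "(\<lambda>z. 0) \<in> Sigma_h \<Omega> \<T>"
proof -
  have "(\<lambda>z. 0) \<in> Sigma_loc"
    unfolding Sigma_loc_iff by (intro exI[of _ 0]) (simp add: transpose_eq_iff)
  moreover have "(\<lambda>z. 0) \<in> L2_sym \<Omega>"
    by (simp add: L2_sym_def L2_zero transpose_eq_iff)
  moreover have "continuous_across \<T> (\<lambda>w. 0) e z" for e z
    unfolding continuous_across_def by (intro exI[of _ 0]) simp
  ultimately show ?thesis by (auto simp: Sigma_h_def)
qed

lemma V_h_subspace: "fun_subspace (V_h \<Omega> \<T>)"
proof -
  have "(\<lambda>z. 0) \<in> V_h \<Omega> \<T>" by (simp add: V_h_def L2_zero)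
  moreover have "(\<lambda>z. a *\<^sub>R v z + b *\<^sub>R w z) \<in> V_h \<Omega> \<T>" if "v \<in> V_h \<Omega> \<T>" "w \<in> V_h \<Omega> \<T>" for a b v w
  proof -
    have "\<exists>c. \<forall>z\<in>interior K. a *\<^sub>R v z + b *\<^sub>R w z = c" if "K \<in> \<T>" for K
    proof -
      obtain c d where "\<forall>z\<in>interior K. v z = c" "\<forall>z\<in>interior K. w z = d"
        using \<open>v \<in> V_h \<Omega> \<T>\<close> \<open>w \<in> V_h \<Omega> \<T>\<close> \<open>K \<in> \<T>\<close> unfolding V_h_def by blast
      then show ?thesis by (intro exI[of _ "a *\<^sub>R c + b *\<^sub>R d"]) simp
    qed
    then show ?thesis using that by (simp add: V_h_def L2_lincomb)
  qed
  ultimately show ?thesis unfolding fun_subspace_def by blast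
qed

lemma Sigma_h_affine:
  assumes "\<tau> \<in> Sigma_h \<Omega> \<T>" "K \<in> \<T>"
  obtains M0 M1 M2 where "\<And>w. w \<in> interior K \<Longrightarrow> \<tau> w = M0 + w$1 *\<^sub>R M1 + w$2 *\<^sub>R M2"
proof -
  obtain p where "p \<in> Sigma_loc" "\<forall>z\<in>interior K. \<tau> z = p z" using Sigma_h_local[OF assms] by blast
  moreover from this obtain M0 M1 M2 where "\<forall>z. p z = M0 + z$1 *\<^sub>R M1 + z$2 *\<^sub>R M2"
    unfolding Sigma_loc_iff by blast
  ultimately show ?thesis using that[of M0 M1 M2] by simp
qed

lemma div_h_affine:
  assumes "K \<in> \<T>" "\<And>w. w \<in> interior K \<Longrightarrow> \<tau> w = M0 + w$1 *\<^sub>R M1 + w$2 *\<^sub>R M2" "z \<in> interior K"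
  shows "div_h \<T> \<tau> z = (\<chi> i. M1$i$1 + M2$i$2)"
  using assms divergence_affine[OF open_interior assms(3) assms(2)] by (auto simp: div_h_def)

lemma div_h_lincomb:
  assumes "\<sigma> \<in> Sigma_h \<Omega> \<T>" "\<tau> \<in> Sigma_h \<Omega> \<T>"
  shows "div_h \<T> (\<lambda>z. a *\<^sub>R \<sigma> z + b *\<^sub>R \<tau> z) = (\<lambda>z. a *\<^sub>R div_h \<T> \<sigma> z + b *\<^sub>R div_h \<T> \<tau> z)"
proof
  fix z
  show "div_h \<T> (\<lambda>z. a *\<^sub>R \<sigma> z + b *\<^sub>R \<tau> z) z = a *\<^sub>R div_h \<T> \<sigma> z + b *\<^sub>R div_h \<T> \<tau> z"
  proof (cases "\<exists>K\<in>\<T>. z \<in> interior K")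
    case True
    then obtain K where K: "K \<in> \<T>" "z \<in> interior K" by blast
    obtain M0 M1 M2 where M: "\<And>w. w \<in> interior K \<Longrightarrow> \<sigma> w = M0 + w$1 *\<^sub>R M1 + w$2 *\<^sub>R M2"
      using Sigma_h_affine[OF assms(1) K(1)] by blast
    obtain N0 N1 N2 where N: "\<And>w. w \<in> interior K \<Longrightarrow> \<tau> w = N0 + w$1 *\<^sub>R N1 + w$2 *\<^sub>R N2"
      using Sigma_h_affine[OF assms(2) K(1)] by blast
    have "a *\<^sub>R \<sigma> w + b *\<^sub>R \<tau> w = (a *\<^sub>R M0 + b *\<^sub>R N0) + w$1 *\<^sub>R (a *\<^sub>R M1 + b *\<^sub>R N1) + w$2 *\<^sub>R (a *\<^sub>R M2 + b *\<^sub>R N2)"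
      if "w \<in> interior K" for w
      by (simp add: M[OF that] N[OF that] algebra_simps)
    from div_h_affine[OF K(1) this K(2)] show ?thesis
      by (simp add: div_h_affine[OF K(1) M K(2)] div_h_affine[OF K(1) N K(2)] vec_eq_iff algebra_simps)
  qed (simp add: div_h_def)
qed

lemma sum_indicator_interior:
  fixes c :: "(real^2) set \<Rightarrow> 'a::real_vector"
  assumes K: "K \<in> \<T>" "z \<in> interior K"
  shows "(\<Sum>L\<in>\<T>. indicator (interior L) z *\<^sub>R c L) = c K"
proof -
  have "indicator (interior L) z *\<^sub>R c L = (if L = K then c K else 0)" if "L \<in> \<T>" for L
  proof (cases "L = K")
    case False
    then have "z \<notin> interior L" using interior_unique[OF that K(1) _ K(2)] by blast
    then show ?thesis using False by simp
  qed (use K(2) in simp)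
  then show ?thesis using K(1) finite_grid by simp
qed

lemma div_h_in_V_h:
  assumes "\<tau> \<in> Sigma_h \<Omega> \<T>" shows "div_h \<T> \<tau> \<in> V_h \<Omega> \<T>"
proof -
  have "\<exists>c. \<forall>z\<in>interior K. div_h \<T> \<tau> z = c" if K: "K \<in> \<T>" for K
  proof -
    obtain M0 M1 M2 where M: "\<And>w. w \<in> interior K \<Longrightarrow> \<tau> w = M0 + w$1 *\<^sub>R M1 + w$2 *\<^sub>R M2"
      using Sigma_h_affine[OF assms K] by blast
    show ?thesis using div_h_affine[OF K M] by blast
  qed
  then have "\<forall>K\<in>\<T>. \<exists>c. \<forall>z\<in>interior K. div_h \<T> \<tau> z = c" by blast
  from bchoice[OF this] obtain c
    where c: "\<And>K z. K \<in> \<T> \<Longrightarrow> z \<in> interior K \<Longrightarrow> div_h \<T> \<tau> z = c K" by blast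
  have eq: "div_h \<T> \<tau> z = (\<Sum>K\<in>\<T>. indicator (interior K) z *\<^sub>R c K)" for z
  proof (cases "\<exists>K\<in>\<T>. z \<in> interior K")
    case True
    then obtain K where K: "K \<in> \<T>" "z \<in> interior K" by blast
    show ?thesis using c[OF K] by (simp add: sum_indicator_interior[OF K])
  next
    case False
    then show ?thesis by (auto simp: div_h_def intro!: sum.neutral[symmetric])
  qed
  have "div_h \<T> \<tau> \<in> L2 \<Omega>"
  proof (rule L2_bounded[OF _ domain_lmeasurable])
    have "(\<lambda>z. \<Sum>K\<in>\<T>. indicator (interior K) z *\<^sub>R c K) \<in> borel_measurable borel"
      by measurable
    then show "div_h \<T> \<tau> \<in> borel_measurable (lebesgue_on \<Omega>)"
      unfolding eq[abs_def] by (rule borel_measurable_lebesgue_onI)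
    show "norm (div_h \<T> \<tau> z) \<le> (\<Sum>K\<in>\<T>. norm (c K))" for z
      unfolding eq by (rule sum_norm_le) (auto simp: indicator_def)
  qed
  then show ?thesis using c unfolding V_h_def by auto
qed

lemma div_h_L2: "\<tau> \<in> Sigma_h \<Omega> \<T> \<Longrightarrow> div_h \<T> \<tau> \<in> L2 \<Omega>"
  using div_h_in_V_h V_h_L2 by blast

lemma Z_h_subspace: "fun_subspace (Z_h \<Omega> \<T>)"
proof -
  have "(\<lambda>z. 0) \<in> Z_h \<Omega> \<T>"
  proof -
    have "div_h \<T> (\<lambda>z. 0) = (\<lambda>z. 0)"
      using div_h_lincomb[OF zero_in_Sigma_h zero_in_Sigma_h, of 0 0] by simp
    then show ?thesis using zero_in_Sigma_h by (simp add: Z_h_def L2_inner_def)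
  qed
  moreover have "(\<lambda>z. a *\<^sub>R \<sigma> z + b *\<^sub>R \<tau> z) \<in> Z_h \<Omega> \<T>" if "\<sigma> \<in> Z_h \<Omega> \<T>" "\<tau> \<in> Z_h \<Omega> \<T>" for a b \<sigma> \<tau>
    using that Sigma_h_lincomb div_h_lincomb
    by (auto simp: Z_h_def L2_inner_lincomb_left[OF V_h_L2 div_h_L2 div_h_L2])
  ultimately show ?thesis unfolding fun_subspace_def by blast
qed

text \<open>This is where \<open>div\<^sub>h \<Sigma>\<^sub>h \<subseteq> V\<^sub>h\<close> enters: the divergence itself is an admissible test function.\<close>

lemma Z_h_div_free: "\<tau> \<in> Z_h \<Omega> \<T> \<Longrightarrow> L2_eq \<Omega> (div_h \<T> \<tau>) (\<lambda>_. 0)"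
  using div_h_in_V_h div_h_L2 L2_inner_self_eq_0 unfolding Z_h_def by blast

text \<open>Functions in \<open>V\<^sub>h\<close> are represented by their values at the centres, where they are free of the
  arbitrary values on element boundaries.\<close>

definition centre :: "(real^2) set \<Rightarrow> real^2" where
  "centre K = midpoint (lo K) (hi K)"

lemma centre_interior: "K \<in> \<T> \<Longrightarrow> centre K \<in> interior K"
  using grid_bounds(2)[of K] by (simp add: mem_interior_grid centre_def midpoint_def)

lemma V_h_const: "v \<in> V_h \<Omega> \<T> \<Longrightarrow> K \<in> \<T> \<Longrightarrow> z \<in> interior K \<Longrightarrow> v z = v (centre K)"
  using centre_interior unfolding V_h_def by fastforce

lemma V_h_separated:
  assumes "v \<in> V_h \<Omega> \<T>" "\<And>K. K \<in> \<T> \<Longrightarrow> v (centre K) = 0" shows "L2_eq \<Omega> v (\<lambda>_. 0)"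
  using V_h_const[OF assms(1)] assms(2) by (intro L2_eq_if_eq_on_interiors) simp

text \<open>Together with the centre, two further points of the interior that are not collinear with it and hence
  determine an affine function.\<close>

definition off_centre :: "(real^2) set \<Rightarrow> 2 \<Rightarrow> real^2" where
  "off_centre K k = centre K + ((hi K $ k - lo K $ k) / 4) *\<^sub>R axis k 1"

lemma Sigma_h_separated:
  assumes \<tau>: "\<tau> \<in> Sigma_h \<Omega> \<T>" and 0: "\<And>K. K \<in> \<T> \<Longrightarrow> \<tau> (centre K) = 0"
    "\<And>K k. K \<in> \<T> \<Longrightarrow> \<tau> (off_centre K k) = 0"
  shows "L2_eq \<Omega> \<tau> (\<lambda>_. 0)"
proof (rule L2_eq_if_eq_on_interiors)
  fix K z assume K: "K \<in> \<T>" and z: "z \<in> interior K"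
  obtain M0 M1 M2 where M: "\<And>w. w \<in> interior K \<Longrightarrow> \<tau> w = M0 + w$1 *\<^sub>R M1 + w$2 *\<^sub>R M2"
    using Sigma_h_affine[OF \<tau> K] by blast
  have lt: "lo K $ k < hi K $ k" for k using grid_bounds(2)[OF K] .
  have off: "off_centre K k \<in> interior K" for k
    using lt[of k] lt by (auto simp: mem_interior_grid[OF K] off_centre_def centre_def midpoint_def axis_def field_simps)
  have c: "M0 + centre K $ 1 *\<^sub>R M1 + centre K $ 2 *\<^sub>R M2 = 0"
    using M[OF centre_interior[OF K]] 0(1)[OF K] by simp
  have "\<tau> (off_centre K 1) =
      (M0 + centre K $ 1 *\<^sub>R M1 + centre K $ 2 *\<^sub>R M2) + ((hi K $ 1 - lo K $ 1) / 4) *\<^sub>R M1"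
    unfolding M[OF off] by (simp add: off_centre_def axis_def scaleR_add_left)
  then have "M1 = 0" using lt[of 1] c 0(2)[OF K] by auto
  moreover have "\<tau> (off_centre K 2) =
      (M0 + centre K $ 1 *\<^sub>R M1 + centre K $ 2 *\<^sub>R M2) + ((hi K $ 2 - lo K $ 2) / 4) *\<^sub>R M2"
    unfolding M[OF off] by (simp add: off_centre_def axis_def scaleR_add_left)
  then have "M2 = 0" using lt[of 2] c 0(2)[OF K] by auto
  ultimately show "\<tau> z = 0" using c M[OF z] by simp
qed

section \<open>A right inverse of the divergence\<close>

text \<open>The diagonal matrix field whose \<open>i\<close>-th diagonal entry is the primitive of \<open>v\<^sub>i\<close> in direction \<open>i\<close>.
  For \<open>v \<in> V\<^sub>h\<close> its elementwise divergence is \<open>v\<close>.\<close>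

definition stress :: "(real^2 \<Rightarrow> real^2) \<Rightarrow> real^2 \<Rightarrow> real^2^2" where
  "stress v z = (\<chi> i j. if i = j then primitive (\<lambda>K. v (centre K) $ i) i z else 0)"

lemma stress_lincomb:
  "stress (\<lambda>x. a *\<^sub>R v x + b *\<^sub>R w x) = (\<lambda>z. a *\<^sub>R stress v z + b *\<^sub>R stress w z)"
  by (simp add: stress_def fun_eq_iff vec_eq_iff primitive_lincomb)

lemma stress_affine:
  assumes "K \<in> \<T>"
  shows "\<exists>M0 M1 M2. (\<forall>w\<in>interior K. stress v w = M0 + w$1 *\<^sub>R M1 + w$2 *\<^sub>R M2) \<and>
    transpose M0 = M0 \<and> transpose M1 = M1 \<and> transpose M2 = M2 \<and> M2$1$1 = 0 \<and> M1$2$2 = 0 \<and>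
    (\<chi> i. M1$i$1 + M2$i$2) = v (centre K)"
proof -
  define c where "c i = v (centre K) $ i" for i
  define d where "d i = row_primitive (\<lambda>K. v (centre K) $ i) i K (lo K $ i) - c i * lo K $ i" for i
  define M0 where "M0 = (\<chi> i j. if i = j then d i else 0)"
  define M1 where "M1 = (\<chi> i j. if i = j \<and> i = 1 then c i else (0::real))"
  define M2 where "M2 = (\<chi> i j. if i = j \<and> i = 2 then c i else (0::real))"
  have "stress v w = M0 + w$1 *\<^sub>R M1 + w$2 *\<^sub>R M2" if w: "w \<in> interior K" for w
  proof -
    have "primitive (\<lambda>K. v (centre K) $ i) i w = d i + c i * w $ i" for i
    proof -
      have "lo K $ i \<le> w $ i" "w $ i \<le> hi K $ i"
        using w mem_interior_grid[OF assms] by (auto simp: less_imp_le)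
      from row_primitive_affine[OF assms this, of "\<lambda>K. v (centre K) $ i"]
      show ?thesis by (simp add: primitive_interior[OF assms w] d_def c_def algebra_simps)
    qed
    then show ?thesis
      by (simp add: stress_def vec_eq_iff forall_2 M0_def M1_def M2_def algebra_simps)
  qed
  moreover have "transpose M0 = M0" "transpose M1 = M1" "transpose M2 = M2" "M2$1$1 = 0" "M1$2$2 = 0"
    by (simp_all add: transpose_eq_iff M0_def M1_def M2_def)
  moreover have "(\<chi> i. M1$i$1 + M2$i$2) = v (centre K)"
    by (simp add: vec_eq_iff forall_2 M1_def M2_def c_def)
  ultimately show ?thesis by blast
qed

lemma div_stress:
  assumes "v \<in> V_h \<Omega> \<T>" shows "L2_eq \<Omega> (div_h \<T> (stress v)) v"
proof (rule L2_eq_if_eq_on_interiors)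
  fix K z assume K: "K \<in> \<T>" and z: "z \<in> interior K"
  obtain M0 M1 M2 where M: "\<And>w. w \<in> interior K \<Longrightarrow> stress v w = M0 + w$1 *\<^sub>R M1 + w$2 *\<^sub>R M2"
    and div: "(\<chi> i. M1$i$1 + M2$i$2) = v (centre K)"
    using stress_affine[OF K, of v] by blast
  show "div_h \<T> (stress v) z = v z"
    using div_h_affine[OF K M z] V_h_const[OF assms K z] div by simp
qed

lemma stress_L2_sym: "stress v \<in> L2_sym \<Omega>"
proof -
  have [measurable]: "(\<lambda>z. stress v z $ i $ j) \<in> borel_measurable (lebesgue_on \<Omega>)" for i j
    by (cases "i = j") (simp_all add: stress_def borel_measurable_lebesgue_onI)
  have "stress v z = (\<Sum>i\<in>UNIV. \<Sum>j\<in>UNIV. (stress v z $ i $ j) *\<^sub>R axis i (axis j 1))" for z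
    by (simp add: vec_eq_iff forall_2 UNIV_2 axis_def)
  then have "stress v = (\<lambda>z. \<Sum>i\<in>UNIV. \<Sum>j\<in>UNIV. (stress v z $ i $ j) *\<^sub>R axis i (axis j 1))" by blast
  then have "stress v \<in> borel_measurable (lebesgue_on \<Omega>)"
    by (rule ssubst) measurable
  moreover have "(norm (stress v z))\<^sup>2 = (\<Sum>i\<in>UNIV. (primitive (\<lambda>K. v (centre K) $ i) i z)\<^sup>2)" for z
    unfolding power2_norm_eq_inner by (simp add: inner_vec_def stress_def UNIV_2 power2_eq_square)
  then have "integrable (lebesgue_on \<Omega>) (\<lambda>z. (norm (stress v z))\<^sup>2)"
    by (simp add: primitive_square_integral(1))
  ultimately show ?thesis by (simp add: L2_sym_def L2_def transpose_eq_iff stress_def)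
qed

text \<open>Across an edge perpendicular to direction \<open>i\<close> both traces are given by the continuous function
  \<open>row_primitive\<close> of the common row.\<close>

lemma primitive_continuous_across:
  assumes e: "e edge_of K0" "K0 \<in> \<T>" and z: "z \<in> e"
    and perp: "\<exists>c. \<forall>z\<in>e. z$i = c"
  shows "continuous_across \<T> (primitive c i) e z"
proof -
  have "aff_dim e = 1" and eK0: "e \<subseteq> K0" using e(1) by (auto simp: edge_of_def face_of_imp_subset)
  \<comment> \<open>The edge is not a single point.\<close>
  then obtain q where q: "q \<in> e" "q \<noteq> z"
    using z by (metis aff_dim_sing insertI1 subset_singletonD subsetI zero_neq_one singletonI ex_in_conv insert_absorb)
  have neq: "q $ j \<noteq> z $ j" if "j \<noteq> i" for j
  proof
    assume *: "q $ j = z $ j"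
    have "q $ i = z $ i" using perp q(1) z by auto
    then have "q $ k = z $ k" for k
      using * that exhaust_2[of i] exhaust_2[of j] exhaust_2[of k] by auto
    then show False using q(2) by (simp add: vec_eq_iff)
  qed
  have "(primitive c i \<longlongrightarrow> row_primitive c i K0 (z$i)) (at z within interior K)" if K: "K \<in> \<T>" "e \<subseteq> K" for K
  proof -
    have "grid_row i K = grid_row i K0"
      using K eK0 q(1) z neq by (intro row_eq_if_shared_points[OF K(1) e(2), of q z]) auto
    then have eq: "row_primitive c i K0 (w$i) = primitive c i w" if "w \<in> interior K" for w
      using primitive_interior[OF K(1) that, of c i] by (simp add: row_primitive_def)
    have "((\<lambda>w. row_primitive c i K0 (w$i)) \<longlongrightarrow> row_primitive c i K0 (z$i)) (at z within interior K)"
      unfolding row_primitive_def by (intro tendsto_intros)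
    then show ?thesis
      by (rule Lim_transform_within[OF _ zero_less_one]) (simp add: eq)
  qed
  then show ?thesis unfolding continuous_across_def by blast
qed

lemma stress_in_Sigma_h: "stress v \<in> Sigma_h \<Omega> \<T>"
proof -
  have "\<exists>p\<in>Sigma_loc. \<forall>z\<in>interior K. stress v z = p z" if K: "K \<in> \<T>" for K
  proof -
    obtain M0 M1 M2 where M: "\<And>w. w \<in> interior K \<Longrightarrow> stress v w = M0 + w$1 *\<^sub>R M1 + w$2 *\<^sub>R M2"
      and sym: "transpose M0 = M0" "transpose M1 = M1" "transpose M2 = M2" "M2$1$1 = 0" "M1$2$2 = 0"
      using stress_affine[OF K, of v] by blast
    have "(\<lambda>w. M0 + w$1 *\<^sub>R M1 + w$2 *\<^sub>R M2) \<in> Sigma_loc"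
      unfolding Sigma_loc_iff using sym by blast
    then show ?thesis by (rule rev_bexI) (simp add: M)
  qed
  moreover have "(\<lambda>w. stress v w $ 1 $ 1) = primitive (\<lambda>K. v (centre K) $ 1) 1"
    "(\<lambda>w. stress v w $ 2 $ 2) = primitive (\<lambda>K. v (centre K) $ 2) 2"
    "(\<lambda>w. stress v w $ 1 $ 2) = (\<lambda>w. 0)"
    by (auto simp: stress_def)
  moreover have "continuous_across \<T> (\<lambda>w. 0) e z" for e z
    unfolding continuous_across_def by (intro exI[of _ 0]) simp
  ultimately show ?thesis
    unfolding Sigma_h_def
    by (auto simp: stress_L2_sym interior_edges_def vertical_def horizontal_def intro: primitive_continuous_across)
qed

lemma V_h_inner_self:
  assumes "v \<in> V_h \<Omega> \<T>"
  shows "L2_inner \<Omega> v v = (\<Sum>K\<in>\<T>. (v (centre K) \<bullet> v (centre K)) * measure lebesgue K)"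
proof -
  let ?g = "\<lambda>z. \<Sum>K\<in>\<T>. indicator (interior K) z * (v (centre K) \<bullet> v (centre K))"
  interpret finite_measure "lebesgue_on \<Omega>"
    by (rule finite_measure_lebesgue_on[OF domain_lmeasurable])
  have ind: "integrable (lebesgue_on \<Omega>) (indicator (interior K) :: _ \<Rightarrow> real)" for K
    by (rule integrable_const_bound[where B = 1]) (auto intro!: borel_measurable_lebesgue_onI)
  have m: "measure (lebesgue_on \<Omega>) (interior K \<inter> \<Omega>) = measure lebesgue K" if K: "K \<in> \<T>" for K
  proof -
    have "interior K \<inter> \<Omega> = interior K" using grid_subset[OF K] interior_subset by blast
    moreover from this have "measure (lebesgue_on \<Omega>) (interior K) = measure lebesgue (interior K)"
      using domain_lmeasurable by (intro measure_restrict_space) auto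
    ultimately have "measure (lebesgue_on \<Omega>) (interior K \<inter> \<Omega>) = measure lebesgue (interior K)"
      by simp
    also have "\<dots> = measure lebesgue (box (lo K) (hi K))" using grid_bounds(3)[OF K] by simp
    also have "\<dots> = measure lebesgue (cbox (lo K) (hi K))"
      using measure_lborel_cbox_eq[of "lo K" "hi K"] measure_lborel_box_eq[of "lo K" "hi K"] by simp
    finally show ?thesis using grid_bounds(1)[OF K] by simp
  qed
  have "L2_inner \<Omega> v v = (LINT z|lebesgue_on \<Omega>. ?g z)"
    unfolding L2_inner_def
  proof (rule integral_cong_AE)
    show "AE z in lebesgue_on \<Omega>. v z \<bullet> v z = ?g z"
      using AE_interior
    proof eventually_elim
      fix z assume "\<exists>K\<in>\<T>. z \<in> interior K"
      then obtain K where K: "K \<in> \<T>" "z \<in> interior K" by blast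
      show "v z \<bullet> v z = ?g z"
        using V_h_const[OF assms K] sum_indicator_interior[OF K, of "\<lambda>K. v (centre K) \<bullet> v (centre K)"] by simp
    qed
    show "(\<lambda>z. v z \<bullet> v z) \<in> borel_measurable (lebesgue_on \<Omega>)"
      using L2_integrable_inner[OF V_h_L2 V_h_L2, OF assms assms] by blast
    show "?g \<in> borel_measurable (lebesgue_on \<Omega>)"
      by (rule borel_measurable_lebesgue_onI) measurable
  qed
  also have "\<dots> = (\<Sum>K\<in>\<T>. measure (lebesgue_on \<Omega>) (interior K \<inter> \<Omega>) * (v (centre K) \<bullet> v (centre K)))"
    using ind by simp
  finally show ?thesis by (simp add: m mult.commute)
qed

text \<open>The right inverse \<open>stress\<close> of the divergence is bounded by the diameter of \<open>\<Omega>\<close>, for every grid.\<close>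

lemma stress_bound:
  assumes "v \<in> V_h \<Omega> \<T>"
  shows "L2_inner \<Omega> (stress v) (stress v) \<le> (norm (hi \<Omega> - lo \<Omega>))\<^sup>2 * L2_inner \<Omega> v v"
proof -
  let ?p = "\<lambda>i. primitive (\<lambda>K. v (centre K) $ i) i" and ?D = "norm (hi \<Omega> - lo \<Omega>)"
  have "L2_inner \<Omega> (stress v) (stress v) = (LINT z|lebesgue_on \<Omega>. (\<Sum>i\<in>UNIV. (?p i z)\<^sup>2))"
    unfolding L2_inner_def
    by (intro Bochner_Integration.integral_cong refl) (simp add: inner_vec_def stress_def UNIV_2 power2_eq_square)
  also have "\<dots> = (\<Sum>i\<in>UNIV. LINT z|lebesgue_on \<Omega>. (?p i z)\<^sup>2)"
    by (simp add: primitive_square_integral(1))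
  also have "\<dots> \<le> (\<Sum>i\<in>UNIV. ?D\<^sup>2 * (\<Sum>L\<in>\<T>. (v (centre L) $ i)\<^sup>2 * measure lebesgue L))"
  proof (rule sum_mono)
    fix i :: 2
    have "(hi \<Omega> $ i - lo \<Omega> $ i)\<^sup>2 \<le> ?D\<^sup>2"
      using component_le_norm_cart[of "hi \<Omega> - lo \<Omega>" i] by (simp add: abs_le_square_iff[symmetric])
    then have "(hi \<Omega> $ i - lo \<Omega> $ i)\<^sup>2 * (\<Sum>L\<in>\<T>. (v (centre L) $ i)\<^sup>2 * measure lebesgue L)
        \<le> ?D\<^sup>2 * (\<Sum>L\<in>\<T>. (v (centre L) $ i)\<^sup>2 * measure lebesgue L)"
      by (intro mult_right_mono sum_nonneg) auto
    then show "(LINT z|lebesgue_on \<Omega>. (?p i z)\<^sup>2) \<le> ?D\<^sup>2 * (\<Sum>L\<in>\<T>. (v (centre L) $ i)\<^sup>2 * measure lebesgue L)"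
      using primitive_square_integral(2)[of "\<lambda>K. v (centre K) $ i" i] by linarith
  qed
  also have "\<dots> = ?D\<^sup>2 * L2_inner \<Omega> v v"
    unfolding V_h_inner_self[OF assms] sum_distrib_left[symmetric]
    by (subst sum.swap) (simp add: inner_vec_def power2_eq_square sum_distrib_right)
  finally show ?thesis .
qed

section \<open>The discrete inf-sup condition\<close>

lemma div_stress_inner:
  assumes "v \<in> V_h \<Omega> \<T>" "w \<in> L2 \<Omega>" shows "L2_inner \<Omega> (div_h \<T> (stress v)) w = L2_inner \<Omega> v w"
  by (rule L2_inner_cong[OF div_h_L2[OF stress_in_Sigma_h] V_h_L2[OF assms(1)] div_stress[OF assms(1)] assms(2)])

text \<open>The divergence respects equality almost everywhere: an affine field that vanishes almost everywhere on
  an element vanishes identically in its interior.\<close>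

lemma div_h_null:
  assumes "\<tau> \<in> Sigma_h \<Omega> \<T>" "L2_eq \<Omega> \<tau> (\<lambda>_. 0)" shows "L2_eq \<Omega> (div_h \<T> \<tau>) (\<lambda>_. 0)"
proof (rule L2_eq_if_eq_on_interiors)
  fix K z assume K: "K \<in> \<T>" and z: "z \<in> interior K"
  obtain p where p: "p \<in> Sigma_loc" "\<forall>w\<in>interior K. \<tau> w = p w"
    using Sigma_h_local[OF assms(1) K] by blast
  have "continuous_on (interior K) \<tau>"
    using p Sigma_loc_continuous[OF p(1), of "interior K"] by (simp cong: continuous_on_cong)
  then have "\<tau> w = 0 + w$1 *\<^sub>R 0 + w$2 *\<^sub>R 0" if "w \<in> interior K" for w
    using zero_on_interior_if_L2_eq[OF K assms(2) _ that] by simp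
  from div_h_affine[OF K this z] show "div_h \<T> \<tau> z = 0" by (simp add: vec_eq_iff)
qed

lemma inf_sup_bound:
  "ereal (1 / sqrt ((norm (hi \<Omega> - lo \<Omega>))\<^sup>2 + 1)) \<le> inf_sup \<Omega> \<T>"
  unfolding inf_sup_def
proof (rule INF_greatest)
  fix v assume "v \<in> {v \<in> V_h \<Omega> \<T>. \<not> L2_eq \<Omega> v (\<lambda>_. 0)}"
  then have v: "v \<in> V_h \<Omega> \<T>" and nz: "\<not> L2_eq \<Omega> v (\<lambda>_. 0)" by auto
  let ?C = "sqrt ((norm (hi \<Omega> - lo \<Omega>))\<^sup>2 + 1)" and ?n = "L2_norm \<Omega> v"
  have dv: "div_h \<T> (stress v) \<in> L2 \<Omega>" by (rule div_h_L2[OF stress_in_Sigma_h])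
  have div1: "L2_inner \<Omega> (div_h \<T> (stress v)) v = ?n\<^sup>2"
    unfolding L2_norm_power2 by (rule div_stress_inner[OF v V_h_L2[OF v]])
  have "L2_inner \<Omega> (div_h \<T> (stress v)) (div_h \<T> (stress v)) = L2_inner \<Omega> (div_h \<T> (stress v)) v"
    by (simp add: div_stress_inner[OF v dv] L2_inner_commute)
  with div1 have div2: "(L2_norm \<Omega> (div_h \<T> (stress v)))\<^sup>2 = ?n\<^sup>2"
    by (simp add: L2_norm_power2)
  have n: "?n > 0"
  proof -
    have "?n\<^sup>2 \<noteq> 0" using nz L2_inner_self_eq_0[OF V_h_L2[OF v]] unfolding L2_norm_power2 by simp
    then show ?thesis using L2_norm_nonneg[of \<Omega> v] by (simp add: less_le)
  qed
  let ?H = "Hdiv_norm \<Omega> \<T> (stress v)"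
  have H: "?H \<le> ?C * ?n"
  proof -
    have "(L2_norm \<Omega> (stress v))\<^sup>2 + (L2_norm \<Omega> (div_h \<T> (stress v)))\<^sup>2
        \<le> ((norm (hi \<Omega> - lo \<Omega>))\<^sup>2 + 1) * ?n\<^sup>2"
      using stress_bound[OF v] unfolding div2 by (simp add: L2_norm_power2 algebra_simps)
    then have "?H \<le> sqrt (((norm (hi \<Omega> - lo \<Omega>))\<^sup>2 + 1) * ?n\<^sup>2)"
      unfolding Hdiv_norm_def by (rule real_sqrt_le_mono)
    then show ?thesis using n by (simp add: real_sqrt_mult)
  qed
  have H0: "?H > 0"
    unfolding Hdiv_norm_def div2 using n by (simp add: add_nonneg_pos)
  have "1 / ?C \<le> ?n\<^sup>2 / (?H * ?n)"
  proof -
    have "?C > 0" by (simp add: add_nonneg_pos)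
    then show ?thesis using H H0 n by (simp add: field_simps power2_eq_square)
  qed
  then have le: "ereal (1 / ?C) \<le> ereal (L2_inner \<Omega> (div_h \<T> (stress v)) v / (?H * ?n))"
    unfolding div1 by simp
  have "\<not> L2_eq \<Omega> (stress v) (\<lambda>_. 0)"
  proof
    assume "L2_eq \<Omega> (stress v) (\<lambda>_. 0)"
    from div_h_null[OF stress_in_Sigma_h this] have "L2_inner \<Omega> v (div_h \<T> (stress v)) = 0"
      by (rule L2_inner_null)
    then show False using div1 n by (simp add: L2_inner_commute)
  qed
  then have "stress v \<in> {\<tau> \<in> Sigma_h \<Omega> \<T>. \<not> L2_eq \<Omega> \<tau> (\<lambda>_. 0)}"
    using stress_in_Sigma_h by simp
  then show "ereal (1 / ?C) \<le> (SUP \<tau>\<in>{\<tau> \<in> Sigma_h \<Omega> \<T>. \<not> L2_eq \<Omega> \<tau> (\<lambda>_. 0)}.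
        ereal (L2_inner \<Omega> (div_h \<T> \<tau>) v / (Hdiv_norm \<Omega> \<T> \<tau> * ?n)))"
    by (rule SUP_upper2) (rule le)
qed

section \<open>Ellipticity on the kernel\<close>

lemma Z_h_Sigma_h: "\<tau> \<in> Z_h \<Omega> \<T> \<Longrightarrow> \<tau> \<in> Sigma_h \<Omega> \<T>"
  by (simp add: Z_h_def)

lemma K_ellipticity_bound:
  assumes "\<And>\<tau>. \<tau> \<in> L2_sym \<Omega> \<Longrightarrow> L2_inner \<Omega> (A \<tau>) \<tau> \<ge> \<alpha> * (L2_norm \<Omega> \<tau>)\<^sup>2"
  shows "K_ellipticity \<Omega> A \<T> \<alpha>"
  unfolding K_ellipticity_def
proof
  fix \<tau> assume \<tau>: "\<tau> \<in> Z_h \<Omega> \<T>"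
  have "(Hdiv_norm \<Omega> \<T> \<tau>)\<^sup>2 = (L2_norm \<Omega> \<tau>)\<^sup>2"
    using L2_inner_null[OF Z_h_div_free[OF \<tau>]] by (simp add: Hdiv_norm_def L2_norm_power2 L2_inner_self_nonneg)
  then show "\<alpha> * (Hdiv_norm \<Omega> \<T> \<tau>)\<^sup>2 \<le> L2_inner \<Omega> (A \<tau>) \<tau>"
    using assms[OF Sigma_h_L2_sym[OF Z_h_Sigma_h[OF \<tau>]]] by simp
qed

section \<open>The discrete mixed problem\<close>

lemma V_h_riesz:
  assumes "linear_functional (V_h \<Omega> \<T>) \<phi>"
    and null: "\<And>v. v \<in> V_h \<Omega> \<T> \<Longrightarrow> L2_eq \<Omega> v (\<lambda>_. 0) \<Longrightarrow> \<phi> v = 0"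
  shows "\<exists>u\<in>V_h \<Omega> \<T>. \<forall>v\<in>V_h \<Omega> \<T>. L2_inner \<Omega> u v = \<phi> v"
proof (rule riesz_finite_dimensional[where F = "(\<lambda>(K, i) v. v (centre K) $ i) ` (\<T> \<times> UNIV)"])
  show "L2_inner \<Omega> v v = 0"
    if "v \<in> V_h \<Omega> \<T>" "\<And>l. l \<in> (\<lambda>(K, i) v. v (centre K) $ i) ` (\<T> \<times> UNIV) \<Longrightarrow> l v = 0" for v
  proof (rule L2_inner_null, rule V_h_separated[OF that(1)])
    fix K assume "K \<in> \<T>"
    then have "v (centre K) $ i = 0" for i by (intro that(2)) force
    then show "v (centre K) = 0" by (simp add: vec_eq_iff)
  qed
  show "linear_functional (V_h \<Omega> \<T>) (L2_inner \<Omega> v)" if "v \<in> V_h \<Omega> \<T>" for v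
    unfolding linear_functional_def using that V_h_L2 L2_inner_lincomb by blast
  show "L2_inner \<Omega> v w = 0" if "w \<in> V_h \<Omega> \<T>" "L2_inner \<Omega> w w = 0" for v w
    using that L2_inner_self_eq_0[OF V_h_L2[OF that(1)]] L2_inner_null by blast
  show "\<phi> w = 0" if "w \<in> V_h \<Omega> \<T>" "L2_inner \<Omega> w w = 0" for w
    using that L2_inner_self_eq_0[OF V_h_L2[OF that(1)]] null by blast
qed (use assms finite_grid V_h_subspace in \<open>auto simp: linear_functional_def L2_inner_commute\<close>)

text \<open>A functional on \<open>\<Sigma>\<^sub>h\<close> that vanishes on \<open>Z\<^sub>h\<close> factors through the divergence, because
  \<open>\<tau> - stress (div\<^sub>h \<tau>)\<close> always lies in \<open>Z\<^sub>h\<close>.\<close>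

lemma multiplier_exists:
  assumes lin: "linear_functional (Sigma_h \<Omega> \<T>) \<psi>"
    and null: "\<And>\<tau>. \<tau> \<in> Sigma_h \<Omega> \<T> \<Longrightarrow> L2_eq \<Omega> \<tau> (\<lambda>_. 0) \<Longrightarrow> \<psi> \<tau> = 0"
    and Z: "\<And>\<tau>. \<tau> \<in> Z_h \<Omega> \<T> \<Longrightarrow> \<psi> \<tau> = 0"
  shows "\<exists>u\<in>V_h \<Omega> \<T>. \<forall>\<tau>\<in>Sigma_h \<Omega> \<T>. L2_inner \<Omega> (div_h \<T> \<tau>) u = \<psi> \<tau>"
proof -
  have "\<exists>u\<in>V_h \<Omega> \<T>. \<forall>v\<in>V_h \<Omega> \<T>. L2_inner \<Omega> u v = \<psi> (stress v)"
  proof (rule V_h_riesz)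
    show "linear_functional (V_h \<Omega> \<T>) (\<lambda>v. \<psi> (stress v))"
      unfolding linear_functional_def stress_lincomb
      using linear_functionalD[OF lin stress_in_Sigma_h stress_in_Sigma_h] by blast
    show "\<psi> (stress v) = 0" if "v \<in> V_h \<Omega> \<T>" "L2_eq \<Omega> v (\<lambda>_. 0)" for v
    proof (rule null[OF stress_in_Sigma_h])
      have "L2_inner \<Omega> (stress v) (stress v) \<le> 0"
        using stress_bound[OF that(1)] L2_inner_null[OF that(2)] by simp
      then show "L2_eq \<Omega> (stress v) (\<lambda>_. 0)"
        using L2_inner_self_nonneg[of \<Omega> "stress v"] L2_inner_self_eq_0[OF L2_sym_L2[OF stress_L2_sym]]
        by (metis order_antisym)
    qed
  qed
  then obtain u where u: "u \<in> V_h \<Omega> \<T>" "\<And>v. v \<in> V_h \<Omega> \<T> \<Longrightarrow> L2_inner \<Omega> u v = \<psi> (stress v)"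
    by blast
  have "L2_inner \<Omega> (div_h \<T> \<tau>) u = \<psi> \<tau>" if \<tau>: "\<tau> \<in> Sigma_h \<Omega> \<T>" for \<tau>
  proof -
    let ?s = "stress (div_h \<T> \<tau>)"
    have d: "div_h \<T> \<tau> \<in> V_h \<Omega> \<T>" by (rule div_h_in_V_h[OF \<tau>])
    define \<rho> where "\<rho> = (\<lambda>z. 1 *\<^sub>R \<tau> z + (-1) *\<^sub>R ?s z)"
    have \<rho>: "\<rho> \<in> Sigma_h \<Omega> \<T>" unfolding \<rho>_def by (rule Sigma_h_lincomb[OF \<tau> stress_in_Sigma_h])
    have "L2_inner \<Omega> (div_h \<T> \<rho>) v = 0" if "v \<in> V_h \<Omega> \<T>" for v
      unfolding \<rho>_def div_h_lincomb[OF \<tau> stress_in_Sigma_h]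
        L2_inner_lincomb_left[OF V_h_L2[OF that] V_h_L2[OF d] div_h_L2[OF stress_in_Sigma_h]]
      using div_stress_inner[OF d V_h_L2[OF that]] by simp
    then have "\<psi> \<rho> = 0" using \<rho> by (intro Z) (simp add: Z_h_def)
    then have "\<psi> \<tau> = \<psi> ?s"
      using linear_functionalD[OF lin \<tau> stress_in_Sigma_h, of 1 "-1"] unfolding \<rho>_def by simp
    then show ?thesis using u(2)[OF d] by (simp add: L2_inner_commute)
  qed
  then show ?thesis using u(1) by blast
qed

lemma finite_nodes: "finite (centre ` \<T> \<union> (\<lambda>(K, k). off_centre K k) ` (\<T> \<times> UNIV))"
  using finite_grid by simp

text \<open>The first component is a field with the prescribed divergence, corrected in \<open>Z\<^sub>h\<close> so that \<open>A \<sigma>\<close> is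
  orthogonal to \<open>Z\<^sub>h\<close>; the second one is the multiplier of the resulting functional on \<open>\<Sigma>\<^sub>h\<close>.\<close>

lemma mixed_problem:
  assumes A: "compliance_operator \<Omega> A" and f: "f \<in> L2 \<Omega>"
  shows "\<exists>\<sigma> u. mixed_solution \<Omega> A f \<T> \<sigma> u \<and>
    (\<forall>\<sigma>' u'. mixed_solution \<Omega> A f \<T> \<sigma>' u' \<longrightarrow> L2_eq \<Omega> \<sigma>' \<sigma> \<and> L2_eq \<Omega> u' u)"
proof -
  let ?S = "Sigma_h \<Omega> \<T>" and ?V = "V_h \<Omega> \<T>" and ?Z = "Z_h \<Omega> \<T>"
  obtain \<alpha> where \<alpha>: "\<alpha> > 0" "\<And>\<tau>. \<tau> \<in> L2_sym \<Omega> \<Longrightarrow> L2_inner \<Omega> (A \<tau>) \<tau> \<ge> \<alpha> * (L2_norm \<Omega> \<tau>)\<^sup>2"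
    using A unfolding compliance_operator_def by blast
  have sym: "L2_inner \<Omega> (A \<sigma>) \<tau> = L2_inner \<Omega> (A \<tau>) \<sigma>" if "\<sigma> \<in> ?S" "\<tau> \<in> ?S" for \<sigma> \<tau>
  proof -
    have "L2_inner \<Omega> (A \<sigma>) \<tau> = L2_inner \<Omega> \<sigma> (A \<tau>)"
      using A Sigma_h_L2_sym that unfolding compliance_operator_def by simp
    then show ?thesis by (simp add: L2_inner_commute)
  qed
  have AL2: "A \<tau> \<in> L2 \<Omega>" if "\<tau> \<in> ?S" for \<tau>
    using A Sigma_h_L2_sym[OF that] L2_sym_L2 unfolding compliance_operator_def by blast
  have lin: "linear_functional ?S (L2_inner \<Omega> (A \<sigma>))" if "\<sigma> \<in> ?S" for \<sigma>
    unfolding linear_functional_def using L2_inner_lincomb[OF AL2[OF that] Sigma_h_L2 Sigma_h_L2] by blast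
  have A_lincomb: "L2_inner \<Omega> (A (\<lambda>z. a *\<^sub>R \<rho> z + b *\<^sub>R \<sigma> z)) \<tau> = a * L2_inner \<Omega> (A \<rho>) \<tau> + b * L2_inner \<Omega> (A \<sigma>) \<tau>"
    if "\<rho> \<in> ?S" "\<sigma> \<in> ?S" "\<tau> \<in> ?S" for a b \<rho> \<sigma> \<tau>
    using linear_functionalD[OF lin[OF that(3)] that(1,2)] sym that Sigma_h_lincomb by simp
  have definite: "L2_eq \<Omega> \<tau> (\<lambda>_. 0)" if "\<tau> \<in> ?S" "L2_inner \<Omega> (A \<tau>) \<tau> = 0" for \<tau>
  proof -
    have "\<alpha> * (L2_norm \<Omega> \<tau>)\<^sup>2 \<le> 0" using \<alpha>(2)[OF Sigma_h_L2_sym[OF that(1)]] that(2) by simp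
    then have "L2_inner \<Omega> \<tau> \<tau> = 0"
      using \<alpha>(1) L2_inner_self_nonneg[of \<Omega> \<tau>] by (simp add: L2_norm_power2 mult_le_0_iff)
    then show ?thesis using L2_inner_self_eq_0[OF Sigma_h_L2[OF that(1)]] by simp
  qed
  \<comment> \<open>A stress field with the prescribed divergence.\<close>
  have "\<exists>g\<in>?V. \<forall>v\<in>?V. L2_inner \<Omega> g v = L2_inner \<Omega> f v"
  proof (rule V_h_riesz)
    show "linear_functional ?V (L2_inner \<Omega> f)"
      unfolding linear_functional_def using L2_inner_lincomb[OF f V_h_L2 V_h_L2] by blast
  qed (rule L2_inner_null)
  then obtain g where g: "g \<in> ?V" "\<And>v. v \<in> ?V \<Longrightarrow> L2_inner \<Omega> g v = L2_inner \<Omega> f v" by blast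
  let ?s = "stress g"
  have s: "?s \<in> ?S" by (rule stress_in_Sigma_h)
  let ?P = "centre ` \<T> \<union> (\<lambda>(K, k). off_centre K k) ` (\<T> \<times> UNIV)"
  let ?F = "(\<lambda>(z, i, j) \<tau>. \<tau> z $ i $ j) ` (?P \<times> UNIV \<times> UNIV) :: ((real^2 \<Rightarrow> real^2^2) \<Rightarrow> real) set"
  have ZS: "?Z \<subseteq> ?S" using Z_h_Sigma_h by blast
  have "\<exists>\<zeta>\<in>?Z. \<forall>\<tau>\<in>?Z. L2_inner \<Omega> (A \<zeta>) \<tau> = - L2_inner \<Omega> (A ?s) \<tau>"
  proof (rule riesz_finite_dimensional[where F = ?F])
    show "finite ?F" using finite_nodes by simp
    show "fun_subspace ?Z" by (rule Z_h_subspace)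
    show "linear_functional ?Z l" if "l \<in> ?F" for l
      using that by (auto simp: linear_functional_def)
    show "L2_inner \<Omega> (A \<tau>) \<tau> = 0" if \<tau>: "\<tau> \<in> ?Z" and 0: "\<And>l. l \<in> ?F \<Longrightarrow> l \<tau> = 0" for \<tau>
    proof (rule L2_inner_null)
      have "\<tau> z = 0" if "z \<in> ?P" for z
      proof -
        have "\<tau> z $ i $ j = 0" for i j
          using 0[OF imageI[of "(z, i, j)" "?P \<times> UNIV \<times> UNIV"]] that by simp
        then show ?thesis by (simp add: vec_eq_iff)
      qed
      then show "L2_eq \<Omega> \<tau> (\<lambda>_. 0)"
        using ZS \<tau> by (intro Sigma_h_separated) auto
    qed
    show "linear_functional ?Z (L2_inner \<Omega> (A \<sigma>))" if "\<sigma> \<in> ?Z" for \<sigma>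
      using linear_functional_subset[OF lin ZS] that ZS by blast
    show "L2_inner \<Omega> (A \<sigma>) \<tau> = L2_inner \<Omega> (A \<tau>) \<sigma>" if "\<sigma> \<in> ?Z" "\<tau> \<in> ?Z" for \<sigma> \<tau>
      using sym that ZS by blast
    show "L2_inner \<Omega> (A \<sigma>) \<tau> = 0" if "\<tau> \<in> ?Z" "L2_inner \<Omega> (A \<tau>) \<tau> = 0" for \<sigma> \<tau>
      using L2_inner_null definite that ZS by blast
    show "- L2_inner \<Omega> (A ?s) \<tau> = 0" if "\<tau> \<in> ?Z" "L2_inner \<Omega> (A \<tau>) \<tau> = 0" for \<tau>
      using L2_inner_null[of \<Omega> \<tau> "A ?s"] definite that ZS by auto
    show "linear_functional ?Z (\<lambda>\<tau>. - L2_inner \<Omega> (A ?s) \<tau>)"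
      using linear_functional_subset[OF lin[OF s] ZS] by (simp add: linear_functional_def)
  qed
  then obtain \<zeta> where \<zeta>: "\<zeta> \<in> ?Z" "\<And>\<tau>. \<tau> \<in> ?Z \<Longrightarrow> L2_inner \<Omega> (A \<zeta>) \<tau> = - L2_inner \<Omega> (A ?s) \<tau>" by blast
  have \<zeta>S: "\<zeta> \<in> ?S" using \<zeta>(1) ZS by blast
  define \<sigma> where "\<sigma> = (\<lambda>z. 1 *\<^sub>R ?s z + 1 *\<^sub>R \<zeta> z)"
  have \<sigma>: "\<sigma> \<in> ?S" unfolding \<sigma>_def by (rule Sigma_h_lincomb[OF s \<zeta>S])
  have div: "L2_inner \<Omega> (div_h \<T> \<sigma>) v = L2_inner \<Omega> f v" if v: "v \<in> ?V" for v
  proof -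
    have "L2_inner \<Omega> (div_h \<T> \<zeta>) v = 0" using \<zeta>(1) v by (simp add: Z_h_def)
    then show ?thesis
      unfolding \<sigma>_def div_h_lincomb[OF s \<zeta>S] L2_inner_lincomb_left[OF V_h_L2[OF v] div_h_L2[OF s] div_h_L2[OF \<zeta>S]]
      using div_stress_inner[OF g(1) V_h_L2[OF v]] g(2)[OF v] by simp
  qed
  have orth: "L2_inner \<Omega> (A \<sigma>) \<tau> = 0" if "\<tau> \<in> ?Z" for \<tau>
    using A_lincomb[OF s \<zeta>S, of \<tau> 1 1] \<zeta>(2)[OF that] that ZS unfolding \<sigma>_def by auto
  have "\<exists>u\<in>?V. \<forall>\<tau>\<in>?S. L2_inner \<Omega> (div_h \<T> \<tau>) u = - L2_inner \<Omega> (A \<sigma>) \<tau>"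
  proof (rule multiplier_exists)
    show "linear_functional ?S (\<lambda>\<tau>. - L2_inner \<Omega> (A \<sigma>) \<tau>)"
      using lin[OF \<sigma>] by (simp add: linear_functional_def)
  qed (simp_all add: L2_inner_null orth)
  then obtain u where u: "u \<in> ?V" "\<And>\<tau>. \<tau> \<in> ?S \<Longrightarrow> L2_inner \<Omega> (div_h \<T> \<tau>) u = - L2_inner \<Omega> (A \<sigma>) \<tau>" by blast
  have sol: "mixed_solution \<Omega> A f \<T> \<sigma> u"
    using \<sigma> u div by (simp add: mixed_solution_def)
  have "L2_eq \<Omega> \<sigma>' \<sigma> \<and> L2_eq \<Omega> u' u" if sol': "mixed_solution \<Omega> A f \<T> \<sigma>' u'" for \<sigma>' u'
  proof -
    have \<sigma>': "\<sigma>' \<in> ?S" and u': "u' \<in> ?V"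
      and eq1: "\<And>\<tau>. \<tau> \<in> ?S \<Longrightarrow> L2_inner \<Omega> (A \<sigma>') \<tau> + L2_inner \<Omega> (div_h \<T> \<tau>) u' = 0"
      and eq2: "\<And>v. v \<in> ?V \<Longrightarrow> L2_inner \<Omega> (div_h \<T> \<sigma>') v = L2_inner \<Omega> f v"
      using sol' by (simp_all add: mixed_solution_def)
    define \<delta> where "\<delta> = (\<lambda>z. 1 *\<^sub>R \<sigma>' z + (-1) *\<^sub>R \<sigma> z)"
    define w where "w = (\<lambda>z. 1 *\<^sub>R u' z + (-1) *\<^sub>R u z)"
    have \<delta>: "\<delta> \<in> ?S" unfolding \<delta>_def by (rule Sigma_h_lincomb[OF \<sigma>' \<sigma>])
    have w: "w \<in> ?V" unfolding w_def by (rule fun_subspaceD[OF V_h_subspace u' u(1)])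
    have div0: "L2_inner \<Omega> (div_h \<T> \<delta>) v = 0" if v: "v \<in> ?V" for v
      unfolding \<delta>_def div_h_lincomb[OF \<sigma>' \<sigma>] L2_inner_lincomb_left[OF V_h_L2[OF v] div_h_L2[OF \<sigma>'] div_h_L2[OF \<sigma>]]
      using eq2[OF v] div[OF v] by simp
    have eq: "L2_inner \<Omega> (A \<delta>) \<tau> + L2_inner \<Omega> (div_h \<T> \<tau>) w = 0" if \<tau>: "\<tau> \<in> ?S" for \<tau>
      unfolding \<delta>_def w_def A_lincomb[OF \<sigma>' \<sigma> \<tau>]
        L2_inner_lincomb[OF div_h_L2[OF \<tau>] V_h_L2[OF u'] V_h_L2[OF u(1)]]
      using eq1[OF \<tau>] u(2)[OF \<tau>] by simp
    have \<delta>0: "L2_eq \<Omega> \<delta> (\<lambda>_. 0)"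
      using eq[OF \<delta>] div0[OF w] by (intro definite[OF \<delta>]) simp
    have "L2_inner \<Omega> (A \<delta>) (stress w) = 0"
      using sym[OF \<delta> stress_in_Sigma_h] L2_inner_null[OF \<delta>0] by simp
    then have "L2_inner \<Omega> w w = 0"
      using eq[OF stress_in_Sigma_h[of w]] div_stress_inner[OF w V_h_L2[OF w]] by simp
    then have w0: "L2_eq \<Omega> w (\<lambda>_. 0)"
      using L2_inner_self_eq_0[OF V_h_L2[OF w]] by simp
    show ?thesis
      using \<delta>0 w0 by (simp add: L2_eq_def \<delta>_def w_def)
  qed
  then show ?thesis using sol by blast
qed

end

section \<open>Stability and unique solvability\<close>

theorem theorem3p1:
  fixes \<Omega> :: "(real^2) set"
    and A :: "(real^2 \<Rightarrow> real^2^2) \<Rightarrow> (real^2 \<Rightarrow> real^2^2)"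
    and grids :: "(real^2) set set set"
  assumes "is_rectangle \<Omega>"
    and "compliance_operator \<Omega> A"
    and "\<forall>\<T>\<in>grids. rectangular_grid \<Omega> \<T>"
  shows "(\<exists>C1>0. \<exists>C2>0. \<forall>\<T>\<in>grids.
            K_ellipticity \<Omega> A \<T> C1 \<and> inf_sup \<Omega> \<T> \<ge> ereal C2) \<and>
         (\<forall>\<T>\<in>grids. \<forall>f\<in>L2 \<Omega>. \<exists>\<sigma> u. mixed_solution \<Omega> A f \<T> \<sigma> u \<and>
            (\<forall>\<sigma>' u'. mixed_solution \<Omega> A f \<T> \<sigma>' u' \<longrightarrow> L2_eq \<Omega> \<sigma>' \<sigma> \<and> L2_eq \<Omega> u' u))"
proof -
  have grid: "grid \<Omega> \<T>" if "\<T> \<in> grids" for \<T>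
    using assms that by unfold_locales auto
  obtain \<alpha> where \<alpha>: "\<alpha> > 0" "\<And>\<tau>. \<tau> \<in> L2_sym \<Omega> \<Longrightarrow> L2_inner \<Omega> (A \<tau>) \<tau> \<ge> \<alpha> * (L2_norm \<Omega> \<tau>)\<^sup>2"
    using assms(2) unfolding compliance_operator_def by blast
  have "0 < 1 / sqrt ((norm (hi \<Omega> - lo \<Omega>))\<^sup>2 + 1)" by (simp add: add_nonneg_pos)
  with \<alpha>(1) have "\<exists>C1>0. \<exists>C2>0. \<forall>\<T>\<in>grids. K_ellipticity \<Omega> A \<T> C1 \<and> inf_sup \<Omega> \<T> \<ge> ereal C2"
    using grid.K_ellipticity_bound[OF grid \<alpha>(2)] grid.inf_sup_bound[OF grid] by blast
  then show ?thesis using grid.mixed_problem[OF grid assms(2)] by blast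
qed

end
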